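(* Let $G=\langle g_\lambda:\lambda\in\Lambda\rangle\in\mathcal{G}_{dis}$ and suppose $J_{\min}(G)\cap\bigcup_{\lambda\in\Lambda}J(g_\lambda)=\emptyset$. Then $\partial\hat K(G)\subset M'\subset\overline{\bigcup_{\lambda\in\Lambda}J(g_\lambda)}$, where $M'$ is the minimal (with respect to the surrounding order) connected component of $\overline{\bigcup_{\lambda\in\Lambda}J(g_\lambda)}$.
   Context: A polynomial semigroup is a semigroup of non-constant complex polynomials (self-maps of $\hat{\mathbb{C}}$) under composition. $F(G)$ is the set of points having a neighborhood on which $G$ is normal, $J(G)=\hat{\mathbb{C}}\setminus F(G)$, $J(g)=J(\langle g\rangle)$. $P(G)$ is the closure of the set of all critical values of all $g\in G$, $P^*(G)=P(G)\setminus\{\infty\}$. $\mathcal{G}$: polynomial semigroups all of whose elements have degree $\ge2$ and with $P^*(G)$ bounded in $\mathbb{C}$; $\mathcal{G}_{dis}$: those with $J(G)$ disconnected. $\hat K(G)=\{z\in\mathbb{C}:\{g(z):g\in G\}\text{ bounded}\}$. For $G\in\mathcal{G}_{dis}$, $J_{\min}(G)$ is the unique connected component of $J(G)$ not containing $\infty$ which meets $\partial\hat K(G)$. Surrounding order: for connected $K_1,K_2\subset\mathbb{C}$, $K_1\le K_2$ means $K_1=K_2$ or $K_1$ lies in a bounded component of $\mathbb{C}\setminus K_2$; the minimal component $M'$ is known to exist for $G\in\mathcal{G}_{dis}$. *)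

theory Defs
  imports "HOL-Analysis.Analysis" "HOL-Computational_Algebra.Polynomial"
begin

inductive_set poly_semigroup :: "complex poly set \<Rightarrow> complex poly set"
  for S :: "complex poly set" where
  gen: "p \<in> S \<Longrightarrow> p \<in> poly_semigroup S"
| comp: "p \<in> poly_semigroup S \<Longrightarrow> q \<in> poly_semigroup S \<Longrightarrow> pcompose p q \<in> poly_semigroup S"

text \<open>Chordal (spherical) distance on C; the Riemann sphere is the completion of C for it.\<close>
definition chordal :: "complex \<Rightarrow> complex \<Rightarrow> real" where
  "chordal z w = 2 * cmod (z - w) / sqrt ((1 + (cmod z)^2) * (1 + (cmod w)^2))"

definition unif_chordal_cauchy_on :: "(nat \<Rightarrow> complex \<Rightarrow> complex) \<Rightarrow> complex set \<Rightarrow> bool" where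
  "unif_chordal_cauchy_on f K \<longleftrightarrow>
     (\<forall>e>0. \<exists>N. \<forall>m\<ge>N. \<forall>n\<ge>N. \<forall>z\<in>K. chordal (f m z) (f n z) < e)"

text \<open>A family F is normal on an open set U of C: every sequence in F has a subsequence
  converging locally uniformly on U (with respect to the spherical metric, limits in the
  Riemann sphere allowed); since the Riemann sphere is the completion of (C, chordal), this
  is the same as the subsequence being uniformly chordal-Cauchy on each compact subset.\<close>
definition normal_on :: "(complex \<Rightarrow> complex) set \<Rightarrow> complex set \<Rightarrow> bool" where
  "normal_on F U \<longleftrightarrow>
     (\<forall>f :: nat \<Rightarrow> complex \<Rightarrow> complex. (\<forall>n. f n \<in> F) \<longrightarrow>
        (\<exists>r. strict_mono r \<and>
             (\<forall>K. compact K \<and> K \<subseteq> U \<longrightarrow> unif_chordal_cauchy_on (f \<circ> r) K)))"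

text \<open>Finite part of the Fatou set F(G) and of the Julia set J(G).\<close>
definition Fatou :: "complex poly set \<Rightarrow> complex set" where
  "Fatou G = {z. \<exists>U. open U \<and> z \<in> U \<and> normal_on (poly ` G) U}"

definition Julia :: "complex poly set \<Rightarrow> complex set" where
  "Julia G = - Fatou G"

definition Julia1 :: "complex poly \<Rightarrow> complex set" where
  "Julia1 g = Julia (poly_semigroup {g})"

text \<open>Whether the point infinity lies in F(G): G (all of whose elements are polynomials, hence
  fix infinity) is normal on some neighbourhood {|z| > R} \<union> {\<infinity>} of infinity.\<close>
definition infinity_in_Fatou :: "complex poly set \<Rightarrow> bool" where
  "infinity_in_Fatou G \<longleftrightarrow>
     (\<exists>R. \<forall>f :: nat \<Rightarrow> complex \<Rightarrow> complex. (\<forall>n. f n \<in> poly ` G) \<longrightarrow>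
        (\<exists>r. strict_mono r \<and> unif_chordal_cauchy_on (f \<circ> r) {z. cmod z > R}))"

text \<open>J(G) (a subset of the Riemann sphere) is disconnected.  If infinity is in F(G), then
  J(G) is the closed set Julia G of C; otherwise J(G) = Julia G \<union> {\<infinity>}, which is
  disconnected iff it splits off a nonempty compact part B \<subseteq> C with the rest closed.\<close>
definition Julia_disconnected :: "complex poly set \<Rightarrow> bool" where
  "Julia_disconnected G \<longleftrightarrow>
     (if infinity_in_Fatou G then \<not> connected (Julia G)
      else (\<exists>B. compact B \<and> B \<noteq> {} \<and> B \<subseteq> Julia G \<and> closed (Julia G - B)))"

definition Pstar :: "complex poly set \<Rightarrow> complex set" where
  "Pstar G = closure {poly g c | g c. g \<in> G \<and> poly (pderiv g) c = 0}"

definition class_G :: "complex poly set \<Rightarrow> bool" where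
  "class_G G \<longleftrightarrow> (\<forall>g\<in>G. degree g \<ge> 2) \<and> bounded (Pstar G)"

definition class_G_dis :: "complex poly set \<Rightarrow> bool" where
  "class_G_dis G \<longleftrightarrow> class_G G \<and> Julia_disconnected G"

definition Khat :: "complex poly set \<Rightarrow> complex set" where
  "Khat G = {z. bounded {poly g z | g. g \<in> G}}"

definition surr_le :: "complex set \<Rightarrow> complex set \<Rightarrow> bool" where
  "surr_le K1 K2 \<longleftrightarrow> K1 = K2 \<or> (\<exists>U \<in> components (- K2). bounded U \<and> K1 \<subseteq> U)"

definition minimal_component :: "complex set \<Rightarrow> complex set \<Rightarrow> bool" where
  "minimal_component M S \<longleftrightarrow>
     M \<in> components S \<and> (\<forall>C \<in> components S. surr_le C M \<longrightarrow> C = M)"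

end

theory Submission
  imports Defs "HOL-Complex_Analysis.Great_Picard" "HOL-Computational_Algebra.Fundamental_Theorem_Algebra"
begin

text \<open>
  Write \<open>K(h)\<close> for the filled Julia set of \<open>h\<close>.  Since the critical values of all elements of \<open>G\<close>
  stay bounded, \<open>K(h)\<close> and its preimages under elements of \<open>G\<close> are full continua, so each \<open>J(h)\<close>
  lies in a single component \<open>C(h)\<close> of \<open>J(G)\<close>, and any two different \<open>C(h)\<close> are nested.  As
  \<open>J(G)\<close> is disconnected, these components are compact.  Pulling back moves components outwards
  towards \<open>J(h)\<close>, so a generator \<open>h\<close> maps the hole of a component \<open>C\<close> enclosing the smallest filled
  Julia set into itself as soon as \<open>C\<close> contains, or is enclosed by, \<open>J(h)\<close>.

  If some generator had a smallest \<open>C(h)\<close>, its hole would be invariant under all of \<open>G\<close>, hence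
  contained in the interior of the smallest filled Julia set; but it contains \<open>J_min\<close>.  So there is
  no smallest one, the sets \<open>K(h)\<close> are directed downwards, and their intersection is invariant,
  hence equal to the smallest filled Julia set.  Its frontier is therefore a connected subset of the
  closure of the union of the \<open>J(h)\<close>, and every other component of that closure encloses it.
\<close>

subsection \<open>The chordal distance and normal families\<close>

lemma chordal_le_dist: "chordal z w \<le> 2 * dist z w"
proof -
  have "1 \<le> (1 + (cmod z)\<^sup>2) * (1 + (cmod w)\<^sup>2)"
    using mult_mono[of 1 "1 + (cmod z)\<^sup>2" 1 "1 + (cmod w)\<^sup>2"] by simp
  then have "1 \<le> sqrt ((1 + (cmod z)\<^sup>2) * (1 + (cmod w)\<^sup>2))"
    by simp
  then show ?thesis
    unfolding chordal_def dist_norm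
    using divide_left_mono[of 1 _ "2 * cmod (z - w)"] by fastforce
qed

text \<open>Inversion is a rotation of the Riemann sphere, hence an isometry. This transfers
  normality from reciprocals, which can be locally bounded when the functions themselves are
  not.\<close>

lemma chordal_inverse:
  assumes "z \<noteq> 0" "w \<noteq> 0"
  shows "chordal (inverse z) (inverse w) = chordal z w"
proof -
  have 1: "cmod (inverse z - inverse w) = cmod (z - w) / (cmod z * cmod w)"
    using assms by (simp add: inverse_diff_inverse norm_mult norm_inverse norm_minus_commute divide_inverse)
  have "(1 + (cmod (inverse z))\<^sup>2) * (1 + (cmod (inverse w))\<^sup>2)
      = ((1 + (cmod z)\<^sup>2) * (1 + (cmod w)\<^sup>2)) / (cmod z * cmod w)\<^sup>2"
    using assms by (simp add: norm_inverse norm_divide field_simps power_mult_distrib)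
  then have 2: "sqrt ((1 + (cmod (inverse z))\<^sup>2) * (1 + (cmod (inverse w))\<^sup>2))
      = sqrt ((1 + (cmod z)\<^sup>2) * (1 + (cmod w)\<^sup>2)) / (cmod z * cmod w)"
    by (simp add: real_sqrt_divide)
  show ?thesis
    unfolding chordal_def 1 2 using assms by simp
qed

text \<open>Affine maps extend smoothly to the sphere, so they are Lipschitz for the spherical
  metric. The constant \<open>M\<close> bounds the ratio of the weights \<open>1 + |z|^2\<close>
  before and after the map, and \<open>L = |c| * M\<close> works.\<close>

lemma chordal_affine_le:
  assumes c: "c \<noteq> 0"
  obtains L where "L > 0" "\<And>z w. chordal (a + c * z) (a + c * w) \<le> L * chordal z w"
proof -
  define M where "M = 1 + (2 + 2 * (cmod a)\<^sup>2) / (cmod c)\<^sup>2"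
  have M: "M \<ge> 1" "M > 0" unfolding M_def by (auto simp: add_pos_nonneg)
  have *: "1 + (cmod z)\<^sup>2 \<le> M * (1 + (cmod (a + c * z))\<^sup>2)" for z
  proof -
    define t where "t = cmod (a + c * z)"
    have "cmod c * cmod z \<le> t + cmod a"
      unfolding t_def using norm_triangle_ineq4[of "a + c * z" a] by (simp add: norm_mult)
    then have "(cmod c * cmod z)\<^sup>2 \<le> (t + cmod a)\<^sup>2"
      by (intro power_mono) auto
    also have "\<dots> \<le> 2 * t\<^sup>2 + 2 * (cmod a)\<^sup>2"
      using sum_squares_bound[of t "cmod a"] by (simp add: power2_sum)
    also have "\<dots> \<le> (2 + 2 * (cmod a)\<^sup>2) * (1 + t\<^sup>2)"
      by (simp add: algebra_simps)
    finally have "(cmod z)\<^sup>2 \<le> (2 + 2 * (cmod a)\<^sup>2) / (cmod c)\<^sup>2 * (1 + t\<^sup>2)"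
      using c by (simp add: power_mult_distrib field_simps)
    moreover have "1 \<le> 1 * (1 + t\<^sup>2)" by simp
    ultimately show ?thesis
      unfolding M_def t_def by (simp only: distrib_right)
  qed
  have "chordal (a + c * z) (a + c * w) \<le> cmod c * M * chordal z w" for z w
  proof -
    have "(1 + (cmod z)\<^sup>2) * (1 + (cmod w)\<^sup>2)
        \<le> (M * (1 + (cmod (a + c * z))\<^sup>2)) * (M * (1 + (cmod (a + c * w))\<^sup>2))"
      using * M by (intro mult_mono) auto
    also have "\<dots> = M\<^sup>2 * ((1 + (cmod (a + c * z))\<^sup>2) * (1 + (cmod (a + c * w))\<^sup>2))"
      by (simp add: power2_eq_square)
    finally have "sqrt ((1 + (cmod z)\<^sup>2) * (1 + (cmod w)\<^sup>2))
        \<le> sqrt (M\<^sup>2 * ((1 + (cmod (a + c * z))\<^sup>2) * (1 + (cmod (a + c * w))\<^sup>2)))"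
      by (rule real_sqrt_le_mono)
    also have "\<dots> = M * sqrt ((1 + (cmod (a + c * z))\<^sup>2) * (1 + (cmod (a + c * w))\<^sup>2))"
      using M by (simp add: real_sqrt_mult)
    finally have s: "sqrt ((1 + (cmod z)\<^sup>2) * (1 + (cmod w)\<^sup>2))
        \<le> M * sqrt ((1 + (cmod (a + c * z))\<^sup>2) * (1 + (cmod (a + c * w))\<^sup>2))" (is "?s \<le> M * ?t") .
    have pos: "?s > 0" "?t > 0"
      by (auto intro!: mult_pos_pos add_pos_nonneg)
    have "cmod ((a + c * z) - (a + c * w)) = cmod c * cmod (z - w)"
      by (simp flip: norm_mult add: algebra_simps)
    then have "chordal (a + c * z) (a + c * w) = 2 * (cmod c * cmod (z - w)) / ?t"
      unfolding chordal_def by simp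
    also have "\<dots> \<le> 2 * (cmod c * cmod (z - w)) / (?s / M)"
    proof (rule divide_left_mono)
      show "?s / M \<le> ?t" using s M by (simp add: field_simps)
    qed (use pos M in auto)
    also have "\<dots> = cmod c * M * chordal z w"
      unfolding chordal_def by simp
    finally show ?thesis .
  qed
  then show ?thesis using that[of "cmod c * M"] c M by simp
qed

lemma unif_chordal_cauchy_on_affine:
  assumes "unif_chordal_cauchy_on f K" "c \<noteq> 0"
  shows "unif_chordal_cauchy_on (\<lambda>n z. a + c * f n z) K"
  unfolding unif_chordal_cauchy_on_def
proof (intro allI impI)
  fix e :: real assume e: "e > 0"
  obtain L where L: "L > 0" "\<And>z w. chordal (a + c * z) (a + c * w) \<le> L * chordal z w"
    using chordal_affine_le[OF assms(2), of a] by blast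
  obtain N where N: "\<forall>m\<ge>N. \<forall>n\<ge>N. \<forall>z\<in>K. chordal (f m z) (f n z) < e / L"
    using assms(1) e L unfolding unif_chordal_cauchy_on_def by (meson divide_pos_pos)
  have "chordal (a + c * f m z) (a + c * f n z) < e" if "m \<ge> N" "n \<ge> N" "z \<in> K" for m n z
  proof -
    have "L * chordal (f m z) (f n z) < e"
      using N that L by (auto simp: field_simps)
    then show ?thesis using L(2) order_le_less_trans by blast
  qed
  then show "\<exists>N. \<forall>m\<ge>N. \<forall>n\<ge>N. \<forall>z\<in>K. chordal (a + c * f m z) (a + c * f n z) < e" by blast
qed

lemma uniform_limit_imp_unif_chordal_cauchy_on:
  assumes "uniform_limit K f l sequentially"
  shows "unif_chordal_cauchy_on f K"
  unfolding unif_chordal_cauchy_on_def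
proof (intro allI impI)
  fix e :: real assume e: "e > 0"
  have "uniformly_Cauchy_on K f"
    using assms by (intro uniformly_convergent_Cauchy uniformly_convergentI)
  then obtain N where N: "\<forall>x\<in>K. \<forall>m\<ge>N. \<forall>n\<ge>N. dist (f m x) (f n x) < e / 2"
    using e unfolding uniformly_Cauchy_on_def by (meson half_gt_zero)
  have "chordal (f m z) (f n z) < e" if "m \<ge> N" "n \<ge> N" "z \<in> K" for m n z
    using N that chordal_le_dist[of "f m z" "f n z"] by fastforce
  then show "\<exists>N. \<forall>m\<ge>N. \<forall>n\<ge>N. \<forall>z\<in>K. chordal (f m z) (f n z) < e" by blast
qed

lemma unif_chordal_cauchy_on_inverse:
  assumes "unif_chordal_cauchy_on (\<lambda>n z. inverse (f n z)) K" "\<And>n z. z \<in> K \<Longrightarrow> f n z \<noteq> 0"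
  shows "unif_chordal_cauchy_on f K"
  using assms unfolding unif_chordal_cauchy_on_def by (simp add: chordal_inverse)

lemma unif_chordal_cauchy_on_subset:
  "unif_chordal_cauchy_on f K \<Longrightarrow> L \<subseteq> K \<Longrightarrow> unif_chordal_cauchy_on f L"
  unfolding unif_chordal_cauchy_on_def by (meson subsetD)

text \<open>Schottky's bound in the form \<open>GPicard3\<close> turns two omitted values and a
  bound at one point into local bounds. The classical Montel theorem for locally bounded families
  then applies.\<close>

lemma Montel_omitting_01:
  fixes f :: "nat \<Rightarrow> complex \<Rightarrow> complex"
  assumes S: "open S" "connected S" "w \<in> S"
    and hol: "\<And>n. f n holomorphic_on S"
    and omit: "\<And>n z. z \<in> S \<Longrightarrow> f n z \<noteq> 0 \<and> f n z \<noteq> 1"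
    and le1: "\<And>n. norm (f n w) \<le> 1"
  obtains r where "strict_mono r" "\<And>K. \<lbrakk>compact K; K \<subseteq> S\<rbrakk> \<Longrightarrow> unif_chordal_cauchy_on (f \<circ> r) K"
proof -
  have bd: "\<exists>B. \<forall>h\<in>range f. \<forall>z\<in>K. norm (h z) \<le> B" if K: "compact K" "K \<subseteq> S" for K
  proof -
    obtain B where "\<And>h z. \<lbrakk>h \<in> range f; z \<in> K\<rbrakk> \<Longrightarrow> norm (h z) \<le> B"
    proof (rule GPicard3[OF S order_refl _ _ _ K, of "range f"])
    qed (use hol omit le1 in auto)
    then show ?thesis by blast
  qed
  show ?thesis
  proof (rule Montel[of S "range f" f])
    show "open S" by (rule S(1))
    show "\<exists>B. \<forall>h\<in>range f. \<forall>z\<in>K. norm (h z) \<le> B" if "compact K" "K \<subseteq> S" for K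
      by (rule bd[OF that])
    show "range f \<subseteq> range f" by simp
    show "h holomorphic_on S" if "h \<in> range f" for h using hol that by auto
  next
    fix g and r :: "nat \<Rightarrow> nat"
    assume "strict_mono r"
      "\<And>K. \<lbrakk>compact K; K \<subseteq> S\<rbrakk> \<Longrightarrow> uniform_limit K (f \<circ> r) g sequentially"
    then show ?thesis
      by (intro that) (auto intro: uniform_limit_imp_unif_chordal_cauchy_on)
  qed
qed

text \<open>Either infinitely many of the functions, suitably normalised to omit 0 and 1, or infinitely
  many of their reciprocals are bounded by 1 at a base point.\<close>

lemma normal_on_omitting_two_values:
  assumes S: "open S" "connected S"
    and hol: "\<And>h. h \<in> F \<Longrightarrow> h holomorphic_on S"
    and ab: "a \<noteq> b"
    and omit: "\<And>h z. h \<in> F \<Longrightarrow> z \<in> S \<Longrightarrow> h z \<noteq> a \<and> h z \<noteq> b"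
  shows "normal_on F S"
proof (cases "S = {}")
  case True
  then show ?thesis
    unfolding normal_on_def unif_chordal_cauchy_on_def
    by (metis empty_iff strict_mono_id subset_empty)
next
  case False
  then obtain w where w: "w \<in> S" by blast
  show ?thesis
    unfolding normal_on_def
  proof (intro allI impI)
    fix f :: "nat \<Rightarrow> complex \<Rightarrow> complex" assume f: "\<forall>n. f n \<in> F"
    define h where "h n z = (f n z - a) / (b - a)" for n z
    have h: "h n holomorphic_on S" "\<And>z. z \<in> S \<Longrightarrow> h n z \<noteq> 0 \<and> h n z \<noteq> 1" for n
      unfolding h_def using f hol omit ab by (auto intro!: holomorphic_intros)
    have fh: "f n = (\<lambda>z. a + (b - a) * h n z)" for n
      using ab by (auto simp: h_def)
    have "\<exists>s. strict_mono (s :: nat \<Rightarrow> nat) \<and> (\<forall>K. compact K \<and> K \<subseteq> S \<longrightarrow> unif_chordal_cauchy_on (h \<circ> s) K)"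
    proof (cases "infinite {n. norm (h n w) \<le> 1}")
      case True
      then obtain s where s: "strict_mono (s :: nat \<Rightarrow> nat)" "\<And>n. norm (h (s n) w) \<le> 1"
        using infinite_enumerate[OF True] by auto
      obtain r where "strict_mono r"
        "\<And>K. \<lbrakk>compact K; K \<subseteq> S\<rbrakk> \<Longrightarrow> unif_chordal_cauchy_on ((\<lambda>n. h (s n)) \<circ> r) K"
        by (rule Montel_omitting_01[OF S w, of "\<lambda>n. h (s n)"]) (use h s(2) in auto)
      then show ?thesis
        using s strict_mono_o[of s r] by (intro exI[of _ "s \<circ> r"]) (auto simp: comp_def)
    next
      case False
      then have "infinite (- {n. norm (h n w) \<le> 1})"
        by (simp add: Compl_eq_Diff_UNIV)
      from infinite_enumerate[OF this]
      obtain s where s: "strict_mono (s :: nat \<Rightarrow> nat)" "\<And>n. \<not> norm (h (s n) w) \<le> 1"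
        by auto
      have *: "norm (inverse (h (s n) w)) \<le> 1" for n
        using s(2)[of n] by (simp add: norm_inverse inverse_le_1_iff)
      obtain r where r: "strict_mono r"
        "\<And>K. \<lbrakk>compact K; K \<subseteq> S\<rbrakk> \<Longrightarrow> unif_chordal_cauchy_on ((\<lambda>n z. inverse (h (s n) z)) \<circ> r) K"
      proof (rule Montel_omitting_01[OF S w, of "\<lambda>n z. inverse (h (s n) z)"])
        show "(\<lambda>z. inverse (h (s n) z)) holomorphic_on S" for n
          using h by (intro holomorphic_intros) auto
        show "inverse (h (s n) z) \<noteq> 0 \<and> inverse (h (s n) z) \<noteq> 1" if "z \<in> S" for n z
          using h(2)[OF that, of "s n"] by simp
      qed (use * in auto)
      have "unif_chordal_cauchy_on (h \<circ> (s \<circ> r)) K" if "compact K" "K \<subseteq> S" for K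
      proof (rule unif_chordal_cauchy_on_inverse)
        show "unif_chordal_cauchy_on (\<lambda>n z. inverse ((h \<circ> (s \<circ> r)) n z)) K"
          using r(2)[OF that] by (simp add: comp_def)
      qed (use h that in auto)
      then show ?thesis
        using s(1) r(1) strict_mono_o[of s r] by (intro exI[of _ "s \<circ> r"]) blast
    qed
    then obtain s where s: "strict_mono (s :: nat \<Rightarrow> nat)"
      "\<And>K. compact K \<and> K \<subseteq> S \<Longrightarrow> unif_chordal_cauchy_on (h \<circ> s) K" by blast
    have "f \<circ> s = (\<lambda>n z. a + (b - a) * (h \<circ> s) n z)"
      by (simp add: fh comp_def)
    then show "\<exists>r. strict_mono r \<and> (\<forall>K. compact K \<and> K \<subseteq> S \<longrightarrow> unif_chordal_cauchy_on (f \<circ> r) K)"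
      using s unif_chordal_cauchy_on_affine[of "h \<circ> s" _ "b - a" a] ab by (intro exI[of _ s]) auto
  qed
qed

subsection \<open>Polynomials as open proper maps\<close>

lemma continuous_on_poly_self: "continuous_on S (poly f)" for f :: "complex poly"
  using continuous_on_poly[OF continuous_on_id, of S f] by simp

lemma open_poly_image:
  fixes f :: "complex poly"
  assumes "degree f > 0" "open S"
  shows "open (poly f ` S)"
proof (rule open_mapping_thm[of "poly f" UNIV])
  show "\<not> poly f constant_on UNIV"
  proof
    assume "poly f constant_on UNIV"
    then obtain c where c: "\<And>z. poly f z = c"
      unfolding constant_on_def by auto
    then have "poly f = poly [:c:]" by auto
    then have "f = [:c:]" by (simp only: poly_eq_poly_eq_iff)
    then show False using assms(1) by simp
  qed
qed (use assms in \<open>auto intro: holomorphic_intros\<close>)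

lemma bounded_poly_vimage:
  fixes f :: "complex poly"
  assumes "degree f > 0" "bounded S"
  shows "bounded (poly f -` S)"
proof -
  obtain a p where f: "f = pCons a p" by (cases f)
  then have p: "p \<noteq> 0" using assms(1) by auto
  obtain B where B: "\<And>x. x \<in> S \<Longrightarrow> cmod x \<le> B"
    using assms(2) by (auto simp: bounded_iff)
  obtain r where r: "\<And>z. r \<le> cmod z \<Longrightarrow> B + 1 \<le> cmod (poly f z)"
    using poly_infinity[OF p] f by blast
  have "cmod z \<le> r" if "z \<in> poly f -` S" for z
    using B[of "poly f z"] r[of z] that by force
  then show ?thesis by (auto simp: bounded_iff)
qed

lemma closed_poly_vimage: "closed S \<Longrightarrow> closed (poly f -` S)" for f :: "complex poly"
  by (intro continuous_closed_vimage) auto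

lemma compact_poly_vimage:
  fixes f :: "complex poly"
  assumes "degree f > 0" "compact S"
  shows "compact (poly f -` S)"
  using assms bounded_poly_vimage closed_poly_vimage by (auto simp: compact_eq_bounded_closed)

text \<open>A polynomial is open and proper. If \<open>f(E)\<close> missed \<open>c\<close>, a
  relatively clopen compact piece \<open>H\<close> of the preimage would contain \<open>E\<close>
  and still avoid the fibre over \<open>c\<close>; yet \<open>f(H)\<close> is clopen and nonempty in
  the connected set \<open>C\<close>.\<close>

lemma component_poly_vimage_surj:
  fixes f :: "complex poly"
  assumes f: "degree f > 0" and C: "compact C" "connected C"
    and E: "E \<in> components (poly f -` C)"
  shows "poly f ` E = C"
proof (rule ccontr)
  assume "poly f ` E \<noteq> C"
  moreover have EC: "E \<subseteq> poly f -` C" using E in_components_subset by blast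
  ultimately obtain c where c: "c \<in> C" "c \<notin> poly f ` E" by blast
  have cK: "compact (poly f -` C)" using compact_poly_vimage[OF f C(1)] .
  have cE: "compact E" using compact_components[OF cK E] .
  have "open (- (poly f -` {c}))"
    using closed_poly_vimage[of "{c}"] by auto
  moreover have "E \<subseteq> - (poly f -` {c})" using c by auto
  ultimately obtain H where H: "openin (top_of_set (poly f -` C)) H" "compact H" "E \<subseteq> H"
      "H \<subseteq> - (poly f -` {c})"
    using Sura_Bura_clopen_subset[OF closed_imp_locally_compact[OF compact_imp_closed[OF cK]] E cE] by metis
  obtain U where U: "open U" "H = poly f -` C \<inter> U"
    using H(1) by (auto simp: openin_open)
  have "poly f ` H = C \<inter> poly f ` U" using U by auto
  then have "openin (top_of_set C) (poly f ` H)"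
    using open_poly_image[OF f U(1)] by (auto simp: openin_open)
  moreover have "closedin (top_of_set C) (poly f ` H)"
  proof (rule closed_subset)
    show "closed (poly f ` H)"
      using H(2) by (intro compact_imp_closed compact_continuous_image continuous_on_poly_self)
  qed (use U in auto)
  moreover have "H \<noteq> {}" using in_components_nonempty[OF E] H by auto
  ultimately have "poly f ` H = C"
    using C(2) by (auto simp: connected_clopen)
  then show False using c H by auto
qed

text \<open>A bounded complementary component \<open>U\<close> has its frontier in the preimage of
  \<open>K\<close>, so \<open>f(U)\<close> is open and closed in the complement of \<open>K\<close>.
  It would thus be the whole complement, which is unbounded.\<close>

lemma connected_Compl_poly_vimage:
  fixes f :: "complex poly"
  assumes f: "degree f > 0" and K: "compact K" "connected (- K)"
  shows "connected (- (poly f -` K))"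
proof (rule ccontr)
  assume "\<not> ?thesis"
  moreover have "bounded (- (- (poly f -` K)))"
    using bounded_poly_vimage[OF f] K compact_imp_bounded by auto
  ultimately obtain U where U: "U \<in> components (- (poly f -` K))" and bU: "bounded U"
    using cobounded_has_bounded_component[of "- (poly f -` K)"] by auto
  show False
  proof -
    have clK: "closed (poly f -` K)" using K compact_imp_closed closed_poly_vimage by blast
    have fr: "frontier U \<subseteq> poly f -` K" using frontier_of_components_closed_complement[OF clK U] .
    have oU: "open U" using open_components[OF _ U] clK by auto
    have U': "U \<subseteq> - (poly f -` K)" using in_components_subset[OF U] .
    have "poly f ` U = poly f ` closure U \<inter> - K"
      using closure_Un_frontier[of U] fr U' by auto
    moreover have "closed (poly f ` closure U)"
      using bU by (intro compact_imp_closed compact_continuous_image continuous_on_poly_self) auto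
    ultimately have "closedin (top_of_set (- K)) (poly f ` U)"
      by (auto simp: closedin_closed)
    moreover have "openin (top_of_set (- K)) (poly f ` U)"
      using open_poly_image[OF f oU] U' by (intro open_subset) auto
    moreover have "U \<noteq> {}" using in_components_nonempty[OF U] .
    ultimately have "poly f ` U = - K"
      using K(2) by (auto simp: connected_clopen)
    moreover have "bounded (poly f ` closure U)"
      using bU by (intro compact_imp_bounded compact_continuous_image continuous_on_poly_self) auto
    then have "bounded (poly f ` U)"
      by (rule bounded_subset) (simp add: closure_subset image_mono)
    ultimately have "bounded (- K)" by simp
    then show False
      using K compact_imp_bounded cobounded_imp_unbounded by blast
  qed
qed


section \<open>Connectedness of polynomial sublevel sets\<close>

lemma closure_poly_sublevel:
  fixes f :: "complex poly"
  assumes f: "degree f > 0" and r: "r > 0"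
  shows "closure {z. cmod (poly f z) < r} = {z. cmod (poly f z) \<le> r}"
proof (rule subset_antisym)
  show "closure {z. cmod (poly f z) < r} \<subseteq> {z. cmod (poly f z) \<le> r}"
    by (rule closure_minimal) (auto intro!: closed_Collect_le continuous_intros)
  show "{z. cmod (poly f z) \<le> r} \<subseteq> closure {z. cmod (poly f z) < r}"
  proof
    fix z assume z: "z \<in> {z. cmod (poly f z) \<le> r}"
    show "z \<in> closure {z. cmod (poly f z) < r}"
      unfolding closure_iff_nhds_not_empty
    proof (intro allI impI)
      fix A U assume "U \<subseteq> A" "z \<in> U" "open U"
      then have "open (poly f ` U)" "poly f z \<in> poly f ` U"
        using open_poly_image[OF f] by auto
      moreover have "poly f z \<in> closure (ball 0 r)"
        using z r by simp
      ultimately have "poly f ` U \<inter> ball 0 r \<noteq> {}"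
        by (metis IntI closure_iff_nhds_not_empty inf.commute order_refl)
      then show "{z. cmod (poly f z) < r} \<inter> A \<noteq> {}"
        using \<open>U \<subseteq> A\<close> by auto
    qed
  qed
qed

text \<open>On a component \<open>W\<close> without zeros the maximum principle applies to
  \<open>1/f\<close>. Since \<open>|f| \<ge> r\<close> on the frontier of \<open>W\<close>, this
  gives \<open>|f| \<ge> r\<close> inside, which is absurd.\<close>

lemma component_poly_sublevel_has_zero:
  fixes f :: "complex poly"
  assumes f: "degree f > 0" and x: "cmod (poly f x) < r"
  obtains a where "poly f a = 0" "connected_component {z. cmod (poly f z) < r} a x"
proof (rule ccontr)
  note witness = that
  assume no: "\<not> thesis"
  define V where "V = {z. cmod (poly f z) < r}"
  define W where "W = connected_component_set V x"
  have "V = poly f -` ball 0 r" by (auto simp: V_def)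
  then have bV: "bounded V" and oV: "open V"
    using bounded_poly_vimage[OF f] by (auto intro!: open_vimage continuous_on_poly_self)
  have W: "W \<in> components V" and xW: "x \<in> W"
    using x by (auto simp: W_def V_def componentsI)
  have oW: "open W" using open_components[OF oV W] .
  have WV: "W \<subseteq> V" by (simp add: W_def connected_component_subset)
  have bW: "bounded W" using bounded_subset[OF bV WV] .
  have fr: "cmod (poly f z) \<ge> r" if "z \<in> frontier W" for z
  proof -
    have "frontier W \<inter> V = {}"
      using frontier_of_components_subset[OF W] frontier_disjoint_eq[of V] oV by blast
    then show ?thesis using that by (auto simp: V_def)
  qed
  have r: "r > 0" using x by (meson norm_ge_zero order_le_less_trans)
  have nz: "poly f z \<noteq> 0" if "z \<in> closure W" for z
  proof (cases "z \<in> W")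
    case True
    then show ?thesis
      using no witness[of z] unfolding W_def V_def
      by (metis connected_component_sym mem_Collect_eq)
  next
    case False
    then have "z \<in> frontier W" using that oW by (simp add: frontier_def interior_open)
    then show ?thesis using fr[of z] r by auto
  qed
  have "cmod (inverse (poly f x)) \<le> inverse r"
  proof (rule maximum_modulus_frontier[of "\<lambda>z. inverse (poly f z)" W])
    show "(\<lambda>z. inverse (poly f z)) holomorphic_on interior W"
      using nz interior_subset closure_subset by (intro holomorphic_intros) blast
    show "continuous_on (closure W) (\<lambda>z. inverse (poly f z))"
      using nz by (intro continuous_intros) auto
    show "cmod (inverse (poly f z)) \<le> inverse r" if "z \<in> frontier W" for z
      using fr[OF that] r by (simp add: norm_inverse le_imp_inverse_le)
  qed (use bW xW in auto)
  moreover have "poly f x \<noteq> 0" using nz xW closure_subset by blast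
  ultimately show False
    using x r by (simp add: norm_inverse inverse_le_iff)
qed

lemma holomorphic_on_poly_self: "poly f holomorphic_on S"
  by (auto intro: holomorphic_intros)

lemma connected_poly_sublevel_if_zeros:
  fixes f :: "complex poly"
  assumes f: "degree f > 0"
    and z: "\<And>a b. poly f a = 0 \<Longrightarrow> poly f b = 0 \<Longrightarrow> connected_component {z. cmod (poly f z) < r} a b"
  shows "connected {z. cmod (poly f z) < r}"
  unfolding connected_iff_connected_component
proof (intro ballI)
  fix x y assume "x \<in> {z. cmod (poly f z) < r}" "y \<in> {z. cmod (poly f z) < r}"
  then obtain a b where "poly f a = 0" "connected_component {z. cmod (poly f z) < r} a x"
    "poly f b = 0" "connected_component {z. cmod (poly f z) < r} b y"
    using component_poly_sublevel_has_zero[OF f] by (metis mem_Collect_eq)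
  then show "connected_component {z. cmod (poly f z) < r} x y"
    using z by (meson connected_component_sym connected_component_trans)
qed

lemma connected_large_poly_sublevel:
  fixes f :: "complex poly"
  assumes f: "degree f > 0"
  obtains r0 where "\<And>r. r \<ge> r0 \<Longrightarrow> connected {z. cmod (poly f z) < r}"
proof -
  have "bounded {a. poly f a = 0}"
    using bounded_poly_vimage[OF f, of "{0}"] by (simp add: vimage_def)
  then obtain s where s: "\<And>a. poly f a = 0 \<Longrightarrow> cmod a \<le> s"
    by (auto simp: bounded_iff)
  have "bounded (poly f ` cball 0 s)"
    by (intro compact_imp_bounded compact_continuous_image continuous_on_poly_self) auto
  then obtain r0 where r0: "\<And>z. cmod z \<le> s \<Longrightarrow> cmod (poly f z) < r0"
    unfolding bounded_pos_less by (metis image_eqI mem_cball_0)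
  have "connected {z. cmod (poly f z) < r}" if "r \<ge> r0" for r
  proof (rule connected_poly_sublevel_if_zeros[OF f])
    fix a b assume "poly f a = 0" "poly f b = 0"
    then have "a \<in> cball 0 s" "b \<in> cball 0 s" using s by auto
    moreover have "cball 0 s \<subseteq> {z. cmod (poly f z) < r}" using r0 that by fastforce
    ultimately show "connected_component {z. cmod (poly f z) < r} a b"
      unfolding connected_component_def using convex_connected[OF convex_cball] by blast
  qed
  then show ?thesis using that by blast
qed

lemma poly_sublevel_Inter:
  fixes f :: "complex poly"
  shows "{z. cmod (poly f z) \<le> r} = (\<Inter>n. {z. cmod (poly f z) \<le> r + inverse (real (Suc n))})"
proof -
  have *: "\<not> (\<forall>n. cmod (poly f z) \<le> r + inverse (real (Suc n)))" if z: "\<not> cmod (poly f z) \<le> r" for z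
  proof -
    obtain n where "inverse (real (Suc n)) < cmod (poly f z) - r"
      using reals_Archimedean[of "cmod (poly f z) - r"] z
      by (metis diff_gt_0_iff_gt linorder_not_le)
    then show ?thesis by (intro notI) (drule spec[of _ n], simp)
  qed
  have "cmod (poly f z) \<le> r + inverse (real (Suc n))" if "cmod (poly f z) \<le> r" for z n
    using that by (simp add: add_increasing2)
  with * show ?thesis by blast
qed

text \<open>The closed sublevel set is a decreasing intersection of compact sets, each the closure
  of a connected open sublevel set.\<close>

lemma connected_poly_closed_sublevel_if:
  fixes f :: "complex poly"
  assumes f: "degree f > 0" and r: "r \<ge> 0"
    and con: "\<And>s. s > r \<Longrightarrow> connected {z. cmod (poly f z) < s}"
  shows "connected {z. cmod (poly f z) \<le> r}"
  unfolding poly_sublevel_Inter[of f r]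
proof (rule connected_nest)
  fix n
  have pos: "r + inverse (real (Suc n)) > r" by simp
  then have "{z. cmod (poly f z) \<le> r + inverse (real (Suc n))}
      = closure {z. cmod (poly f z) < r + inverse (real (Suc n))}"
    using closure_poly_sublevel[OF f] r by (metis order_le_less_trans)
  then show "connected {z. cmod (poly f z) \<le> r + inverse (real (Suc n))}"
    using con[OF pos] connected_imp_connected_closure by metis
  have "{z. cmod (poly f z) \<le> r + inverse (real (Suc n))} = poly f -` cball 0 (r + inverse (real (Suc n)))"
    by auto
  then show "compact {z. cmod (poly f z) \<le> r + inverse (real (Suc n))}"
    using compact_poly_vimage[OF f] by (metis compact_cball)
next
  fix m n :: nat assume "m \<le> n"
  then have "inverse (real (Suc n)) \<le> inverse (real (Suc m))"
    by (intro le_imp_inverse_le) auto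
  then have "r + inverse (real (Suc n)) \<le> r + inverse (real (Suc m))" by simp
  then show "{z. cmod (poly f z) \<le> r + inverse (real (Suc n))} \<subseteq> {z. cmod (poly f z) \<le> r + inverse (real (Suc m))}"
    by (meson Collect_mono order_trans)
qed

text \<open>Two pieces of the sublevel set cannot touch at a regular point of the level set, because
  near such a point the sublevel set is homeomorphic to the intersection of two discs.\<close>

lemma connected_poly_sublevel_at_regular_level:
  fixes f :: "complex poly"
  assumes f: "degree f > 0" and r: "r > 0"
    and con: "connected {z. cmod (poly f z) \<le> r}"
    and reg: "\<And>c. poly (pderiv f) c = 0 \<Longrightarrow> cmod (poly f c) \<noteq> r"
  shows "connected {z. cmod (poly f z) < r}" (is "connected ?V")
proof (rule ccontr)
  assume "\<not> connected ?V"
  have oV: "open ?V" by (auto intro!: open_Collect_less continuous_intros)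
  obtain A B where AB: "open A" "open B" "A \<inter> B \<inter> ?V = {}" "?V \<subseteq> A \<union> B" "A \<inter> ?V \<noteq> {}" "B \<inter> ?V \<noteq> {}"
    using \<open>\<not> connected ?V\<close> unfolding connected_def by auto
  define P where "P = A \<inter> ?V"
  define Q where "Q = B \<inter> ?V"
  have PQ: "open P" "open Q" "P \<inter> Q = {}" "P \<union> Q = ?V" "P \<noteq> {}" "Q \<noteq> {}"
    using AB oV by (auto simp: P_def Q_def)
  have cl: "closure P \<union> closure Q = {z. cmod (poly f z) \<le> r}"
    using closure_poly_sublevel[OF f r] PQ(4) by (metis closure_Un)
  have "closure P \<inter> closure Q \<noteq> {}"
  proof
    assume "closure P \<inter> closure Q = {}"
    then have "closure P \<inter> closure Q \<inter> {z. cmod (poly f z) \<le> r} = {}" by blast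
    from connected_closedD[OF con this] show False
      using cl PQ closure_subset by blast
  qed
  then obtain x where x: "x \<in> closure P" "x \<in> closure Q" by blast
  have "P \<inter> closure Q = {}" "Q \<inter> closure P = {}"
    using PQ by (auto simp: open_Int_closure_eq_empty)
  then have "x \<notin> ?V" using x PQ(4) by blast
  moreover have "x \<in> {z. cmod (poly f z) \<le> r}" using x cl by blast
  ultimately have fx: "cmod (poly f x) = r" by auto
  then have "poly (pderiv f) x \<noteq> 0" using reg by blast
  then have "deriv (poly f) x \<noteq> 0"
    by (metis DERIV_imp_deriv poly_DERIV)
  then obtain e where e: "e > 0" "open (poly f ` ball x e)" "inj_on (poly f) (ball x e)"
    using has_complex_derivative_locally_invertible[of "poly f" UNIV x] holomorphic_on_poly_self
    by (metis UNIV_I open_UNIV)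
  obtain h where h: "h holomorphic_on (poly f ` ball x e)" "\<And>z. z \<in> ball x e \<Longrightarrow> h (poly f z) = z"
    using holomorphic_has_inverse[OF holomorphic_on_poly_self open_ball e(3)] by metis
  obtain d where d: "d > 0" "ball (poly f x) d \<subseteq> poly f ` ball x e"
    using e(1,2) by (metis centre_in_ball imageI open_contains_ball)
  \<comment> \<open>\<open>D\<close> is the part of the sublevel disc near \<open>f(x)\<close>: a
    convex set, which the local inverse \<open>h\<close> carries to a connected set \<open>N\<close>
    inside the sublevel set. Both pieces accumulate at \<open>x\<close>, so \<open>N\<close> meets
    both.\<close>
  define D where "D = ball (poly f x) d \<inter> ball 0 r"
  define N where "N = h ` D"
  have "connected N"
    unfolding N_def
  proof (rule connected_continuous_image)
    show "continuous_on D h"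
      using h(1) d(2) by (intro holomorphic_on_imp_continuous_on) (auto simp: D_def intro: holomorphic_on_subset)
    show "connected D"
      unfolding D_def by (intro convex_connected convex_Int) auto
  qed
  moreover have "N \<subseteq> P \<union> Q"
    using d h(2) unfolding N_def D_def PQ(4) by fastforce
  moreover have ne: "S \<inter> N \<noteq> {}" if S: "x \<in> closure S" "S \<subseteq> ?V" for S
  proof -
    define Nx where "Nx = ball x e \<inter> poly f -` ball (poly f x) d"
    have "open Nx"
      unfolding Nx_def by (intro open_Int open_ball open_vimage continuous_on_poly_self)
    moreover have "x \<in> Nx" using e d by (auto simp: Nx_def)
    ultimately have "Nx \<inter> S \<noteq> {}"
      using S(1) open_Int_closure_eq_empty[of Nx S] by blast
    then obtain y where y: "y \<in> S" "y \<in> ball x e" "poly f y \<in> ball (poly f x) d"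
      by (auto simp: Nx_def)
    then have "y \<in> N"
      unfolding N_def D_def using S(2) h(2)[of y] by (intro image_eqI[of _ _ "poly f y"]) auto
    then show ?thesis using y by blast
  qed
  moreover have "P \<inter> N \<noteq> {}" "Q \<inter> N \<noteq> {}"
    using ne x PQ(4) by blast+
  ultimately show False
    using PQ unfolding connected_def by blast
qed

text \<open>Lower the level from infinity. At the supremum \<open>r\<close> of the bad levels the
  closed sublevel set is connected by intersection, and the open one by regularity. The zeros are
  finitely many and can be joined by paths on which \<open>|f|\<close> stays below some
  \<open>m < r\<close>, so levels just below \<open>r\<close> are good too.\<close>

lemma connected_poly_sublevel:
  fixes f :: "complex poly"
  assumes f: "degree f > 0" and R: "R \<ge> 0"
    and crit: "\<And>c. poly (pderiv f) c = 0 \<Longrightarrow> cmod (poly f c) \<le> R"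
  shows "connected {z. cmod (poly f z) \<le> R}"
proof (rule connected_poly_closed_sublevel_if[OF f R], rule ccontr)
  define T where "T = {r. r > R \<and> \<not> connected {z. cmod (poly f z) < r}}"
  fix r1 assume "r1 > R" "\<not> connected {z. cmod (poly f z) < r1}"
  then have r1: "r1 \<in> T" by (simp add: T_def)
  obtain b where b: "\<And>r. r \<ge> b \<Longrightarrow> connected {z. cmod (poly f z) < r}"
    using connected_large_poly_sublevel[OF f] by blast
  have bdd: "bdd_above T"
    using b unfolding T_def by (intro bdd_aboveI[of _ b]) (metis (mono_tags) linear mem_Collect_eq)
  define r where "r = Sup T"
  have "r1 \<le> r" using cSup_upper[OF r1 bdd] by (simp add: r_def)
  then have r: "r > R" "r > 0" using r1 R by (auto simp: T_def)
  have "connected {z. cmod (poly f z) \<le> r}"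
  proof (rule connected_poly_closed_sublevel_if[OF f])
    fix s assume "s > r"
    then have "s \<notin> T" using cSup_upper[OF _ bdd, of s] by (auto simp: r_def)
    then show "connected {z. cmod (poly f z) < s}" using \<open>s > r\<close> r by (auto simp: T_def)
  qed (use r in auto)
  then have con: "connected {z. cmod (poly f z) < r}"
    using crit r by (intro connected_poly_sublevel_at_regular_level[OF f]) force+
  have "\<exists>s<r. connected_component {z. cmod (poly f z) < s} a b" if ab: "poly f a = 0" "poly f b = 0" for a b
  proof -
    have "open {z. cmod (poly f z) < r}" by (auto intro!: open_Collect_less continuous_intros)
    then have pc: "path_connected {z. cmod (poly f z) < r}"
      using con by (simp add: connected_open_path_connected)
    have "a \<in> {z. cmod (poly f z) < r}" "b \<in> {z. cmod (poly f z) < r}" using ab r by auto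
    then obtain p where p: "path p" "path_image p \<subseteq> {z. cmod (poly f z) < r}" "pathstart p = a" "pathfinish p = b"
      using pc unfolding path_connected_def by blast
    have "compact (path_image p)" "path_image p \<noteq> {}" using p compact_path_image by auto
    then obtain m where m: "m \<in> path_image p" "\<And>z. z \<in> path_image p \<Longrightarrow> cmod (poly f z) \<le> cmod (poly f m)"
      using continuous_attains_sup[of "path_image p" "\<lambda>z. cmod (poly f z)"]
        continuous_on_norm[OF continuous_on_poly_self] by blast
    \<comment> \<open>A compact path in the open sublevel set leaves room below
      \<open>r\<close>.\<close>
    obtain s where s: "cmod (poly f m) < s" "s < r"
      using m p(2) dense[of "cmod (poly f m)" r] by blast
    have "path_image p \<subseteq> {z. cmod (poly f z) < s}"
      using order_le_less_trans[OF m(2) s(1)] by blast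
    then have "connected_component {z. cmod (poly f z) < s} a b"
      unfolding connected_component_def using connected_path_image[OF p(1)] p(3,4)
      by (metis pathfinish_in_path_image pathstart_in_path_image)
    then show ?thesis using s by blast
  qed
  then obtain s where s: "\<And>a b. poly f a = 0 \<Longrightarrow> poly f b = 0 \<Longrightarrow>
      s a b < r \<and> connected_component {z. cmod (poly f z) < s a b} a b"
    by metis
  define Z where "Z = {a. poly f a = 0}"
  have "f \<noteq> 0" using f by auto
  then have fin: "finite Z" unfolding Z_def by (rule poly_roots_finite)
  \<comment> \<open>Inserting \<open>R\<close> keeps the maximum over a nonempty set and preserves
    the bound \<open>m < r\<close>.\<close>
  define m where "m = Max (insert R ((\<lambda>(a, b). s a b) ` (Z \<times> Z)))"
  have "m < r"
    unfolding m_def using fin s r by (subst Max_less_iff) (auto simp: Z_def)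
  then obtain t where t: "t \<in> T" "m < t"
    using less_cSupE[of m T] r1 by (auto simp: r_def)
  have "connected {z. cmod (poly f z) < t}"
  proof (rule connected_poly_sublevel_if_zeros[OF f])
    fix a b assume ab: "poly f a = 0" "poly f b = 0"
    have "s a b \<le> m"
      unfolding m_def using fin ab by (intro Max_ge) (auto simp: Z_def)
    then have "{z. cmod (poly f z) < s a b} \<subseteq> {z. cmod (poly f z) < t}" using t by auto
    then show "connected_component {z. cmod (poly f z) < t} a b"
      using s[OF ab] connected_component_of_subset by blast
  qed
  then show False using t by (simp add: T_def)
qed

subsection \<open>Fatou and Julia sets\<close>

lemma normal_on_mono: "normal_on F U \<Longrightarrow> F' \<subseteq> F \<Longrightarrow> normal_on F' U"
  unfolding normal_on_def by blast

lemma normal_onD: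
  fixes f :: "nat \<Rightarrow> complex \<Rightarrow> complex"
  assumes "normal_on F U" "\<And>n. f n \<in> F"
  obtains r where "strict_mono r" "\<And>K. compact K \<Longrightarrow> K \<subseteq> U \<Longrightarrow> unif_chordal_cauchy_on (f \<circ> r) K"
proof -
  have "\<exists>r. strict_mono r \<and> (\<forall>K. compact K \<and> K \<subseteq> U \<longrightarrow> unif_chordal_cauchy_on (f \<circ> r) K)"
    using assms(1)[unfolded normal_on_def, rule_format, of f] assms(2) .
  then show thesis using that by (elim exE conjE) simp
qed

lemma unif_chordal_cauchy_onD:
  assumes "unif_chordal_cauchy_on f K" "e > 0"
  obtains N where "\<And>m n z. N \<le> m \<Longrightarrow> N \<le> n \<Longrightarrow> z \<in> K \<Longrightarrow> chordal (f m z) (f n z) < e"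
proof -
  have "\<exists>N. \<forall>m\<ge>N. \<forall>n\<ge>N. \<forall>z\<in>K. chordal (f m z) (f n z) < e"
    using assms unfolding unif_chordal_cauchy_on_def by blast
  then show thesis using that by blast
qed

lemma open_Fatou: "open (Fatou G)"
  unfolding Fatou_def by (subst open_subopen) auto

lemma closed_Julia: "closed (Julia G)"
  by (simp add: Julia_def open_Fatou closed_Compl)

lemma Julia_mono: "G' \<subseteq> G \<Longrightarrow> Julia G' \<subseteq> Julia G"
  unfolding Julia_def Fatou_def using normal_on_mono[OF _ image_mono] by blast

lemma Fatou_if_omits:
  assumes "open S" "z \<in> S" "a \<noteq> b"
    and "\<And>h w. h \<in> G \<Longrightarrow> w \<in> S \<Longrightarrow> poly h w \<noteq> a \<and> poly h w \<noteq> b"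
  shows "z \<in> Fatou G"
proof -
  obtain r where r: "r > 0" "ball z r \<subseteq> S"
    using assms(1,2) by (meson open_contains_ball)
  have "normal_on (poly ` G) (ball z r)"
  proof (rule normal_on_omitting_two_values[OF open_ball connected_ball _ assms(3)])
    show "h holomorphic_on ball z r" if "h \<in> poly ` G" for h
      using that holomorphic_on_poly_self by blast
    show "h w \<noteq> a \<and> h w \<noteq> b" if "h \<in> poly ` G" "w \<in> ball z r" for h w
      using that assms(4) r(2) by blast
  qed
  then show ?thesis
    unfolding Fatou_def using r(1) by (auto intro!: exI[of _ "ball z r"])
qed

lemma poly_pcompose_fun: "poly (pcompose p q) = poly p \<circ> poly q"
  by (simp add: fun_eq_iff poly_pcompose)

text \<open>A sequence \<open>f n\<close> near \<open>h(z)\<close> is controlled by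
  \<open>f n \<circ> h\<close> near \<open>z\<close>, which again consists of members of the family.
  Uniform estimates on a disc descend to its image, and this image is open.\<close>

lemma Fatou_image:
  fixes h :: "complex poly"
  assumes comp: "\<And>p. p \<in> G \<Longrightarrow> pcompose p h \<in> G" and h: "degree h > 0"
    and z: "z \<in> Fatou G"
  shows "poly h z \<in> Fatou G"
proof -
  obtain U where U: "open U" "z \<in> U" "normal_on (poly ` G) U"
    using z by (auto simp: Fatou_def)
  obtain r where r: "r > 0" "cball z r \<subseteq> U"
    using U by (meson open_contains_cball)
  have "normal_on (poly ` G) (poly h ` ball z r)"
    unfolding normal_on_def
  proof (intro allI impI)
    fix f :: "nat \<Rightarrow> complex \<Rightarrow> complex" assume f: "\<forall>n. f n \<in> poly ` G"
    have "f n \<circ> poly h \<in> poly ` G" for n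
    proof -
      obtain p where "p \<in> G" "f n = poly p" using f by blast
      then show ?thesis using comp[of p] by (auto simp flip: poly_pcompose_fun)
    qed
    then obtain s where s: "strict_mono s"
      "\<And>K. compact K \<Longrightarrow> K \<subseteq> U \<Longrightarrow> unif_chordal_cauchy_on ((\<lambda>n. f n \<circ> poly h) \<circ> s) K"
      using normal_onD[OF U(3), of "\<lambda>n. f n \<circ> poly h"] by blast
    then have c: "unif_chordal_cauchy_on ((\<lambda>n. f n \<circ> poly h) \<circ> s) (cball z r)"
      using r(2) compact_cball by blast
    have c': "unif_chordal_cauchy_on (f \<circ> s) K" if "K \<subseteq> poly h ` ball z r" for K
      unfolding unif_chordal_cauchy_on_def
    proof (intro allI impI)
      fix e :: real assume "e > 0"
      then obtain N where N: "\<And>m n w. m \<ge> N \<Longrightarrow> n \<ge> N \<Longrightarrow> w \<in> cball z r \<Longrightarrow>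
          chordal (f (s m) (poly h w)) (f (s n) (poly h w)) < e"
        using unif_chordal_cauchy_onD[OF c] by (metis comp_apply)
      have "chordal ((f \<circ> s) m w) ((f \<circ> s) n w) < e" if mn: "m \<ge> N" "n \<ge> N" "w \<in> K" for m n w
      proof -
        obtain v where "v \<in> ball z r" "w = poly h v" using \<open>K \<subseteq> poly h ` ball z r\<close> mn by blast
        then show ?thesis using N[of m n v] mn by simp
      qed
      then show "\<exists>N. \<forall>m\<ge>N. \<forall>n\<ge>N. \<forall>z\<in>K. chordal ((f \<circ> s) m z) ((f \<circ> s) n z) < e" by blast
    qed
    show "\<exists>s. strict_mono s \<and> (\<forall>K. compact K \<and> K \<subseteq> poly h ` ball z r \<longrightarrow> unif_chordal_cauchy_on (f \<circ> s) K)"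
      using s(1) c' by blast
  qed
  moreover have "open (poly h ` ball z r)" using open_poly_image[OF h] by auto
  moreover have "poly h z \<in> poly h ` ball z r" using r(1) by auto
  ultimately show ?thesis unfolding Fatou_def by blast
qed

text \<open>Points of a fixed disc keep a definite chordal distance from points far away. The
  estimate uses \<open>sqrt (1 + |z|^2) \<le> 1 + |z|\<close>, and \<open>|z| > 4 * B + 4\<close>
  makes \<open>2 * |z - w|\<close> exceed \<open>1 + |z|\<close>.\<close>

lemma chordal_less_imp_bounded:
  assumes ch: "chordal z w < 1 / sqrt (1 + B\<^sup>2)" and w: "cmod w \<le> B"
  shows "cmod z \<le> 4 * B + 4"
proof (rule ccontr)
  assume "\<not> ?thesis"
  then have z: "cmod z > 4 * B + 4" by simp
  have B: "B \<ge> 0" using w by (meson norm_ge_zero order_trans)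
  define t where "t = sqrt (1 + B\<^sup>2)"
  have t: "t \<ge> 1" unfolding t_def by simp
  have 1: "sqrt (1 + (cmod w)\<^sup>2) \<le> t"
    unfolding t_def using w by (simp add: power_mono)
  have "1 + (cmod z)\<^sup>2 \<le> (1 + cmod z)\<^sup>2"
    by (simp add: power2_sum)
  then have "sqrt (1 + (cmod z)\<^sup>2) \<le> sqrt ((1 + cmod z)\<^sup>2)"
    by (rule real_sqrt_le_mono)
  then have 2: "sqrt (1 + (cmod z)\<^sup>2) \<le> 1 + cmod z" by simp
  have "sqrt ((1 + (cmod z)\<^sup>2) * (1 + (cmod w)\<^sup>2)) \<le> (1 + cmod z) * t"
    unfolding real_sqrt_mult using 1 2 by (intro mult_mono) auto
  moreover have "sqrt ((1 + (cmod z)\<^sup>2) * (1 + (cmod w)\<^sup>2)) > 0"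
    by (auto intro!: mult_pos_pos add_pos_nonneg)
  moreover have "(1 + cmod z) * t > 0" using t by (intro mult_pos_pos add_pos_nonneg) auto
  ultimately have "2 * cmod (z - w) / ((1 + cmod z) * t) \<le> chordal z w"
    unfolding chordal_def by (intro divide_left_mono mult_pos_pos[of "(1 + cmod z) * t"]) auto
  also have "\<dots> < 1 / t" using ch by (simp add: t_def)
  finally have "2 * cmod (z - w) / (1 + cmod z) / t < 1 / t" by simp
  then have "2 * cmod (z - w) / (1 + cmod z) < 1"
    using t divide_right_mono[of 1 "2 * cmod (z - w) / (1 + cmod z)" t] by linarith
  then have "2 * cmod (z - w) < 1 + cmod z"
    using z B by (simp add: divide_less_eq)
  moreover have "cmod (z - w) \<ge> cmod z - cmod w" by (rule norm_triangle_ineq2)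
  ultimately show False using z w B by argo
qed

text \<open>Normality at a point with bounded orbit forces the orbits of all nearby points to be
  uniformly bounded.\<close>

lemma Fatou_imp_locally_bounded:
  assumes z: "z \<in> Fatou G" and bd: "bounded {poly g z | g. g \<in> G}"
  obtains r B where "r > 0" "\<And>g w. g \<in> G \<Longrightarrow> w \<in> ball z r \<Longrightarrow> cmod (poly g w) \<le> B"
proof (rule ccontr)
  assume no: "\<not> thesis"
  have "\<exists>g w. g \<in> G \<and> w \<in> ball z (inverse (real (Suc n))) \<and> \<not> cmod (poly g w) \<le> real n" for n
  proof (rule ccontr)
    assume "\<not> ?thesis"
    then show False
      using no that[of "inverse (real (Suc n))" "real n"] by auto
  qed
  then obtain g w where g: "\<And>n. g n \<in> G" and w: "\<And>n. w n \<in> ball z (inverse (real (Suc n)))"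
    and big: "\<And>n. \<not> cmod (poly (g n) (w n)) \<le> real n"
    by metis
  obtain U where U: "open U" "z \<in> U" "normal_on (poly ` G) U"
    using z by (auto simp: Fatou_def)
  obtain r where r: "r > 0" "cball z r \<subseteq> U"
    using U by (meson open_contains_cball)
  obtain s where s: "strict_mono s"
      "\<And>K. compact K \<Longrightarrow> K \<subseteq> U \<Longrightarrow> unif_chordal_cauchy_on ((\<lambda>n. poly (g n)) \<circ> s) K"
    using normal_onD[OF U(3), of "\<lambda>n. poly (g n)"] g by blast
  then have c: "unif_chordal_cauchy_on ((\<lambda>n. poly (g n)) \<circ> s) (cball z r)"
    using r(2) compact_cball by blast
  obtain B0 where B0: "\<And>g. g \<in> G \<Longrightarrow> cmod (poly g z) \<le> B0"
    using bd by (auto simp: bounded_iff)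
  \<comment> \<open>The extra 1 pays for moving from \<open>z\<close> to a nearby point: by
    continuity the single map \<open>g (s N)\<close> stays bounded by \<open>B\<close> there. The
    maps \<open>g (s m)\<close> are then compared with it at the points
    \<open>w (s m)\<close>.\<close>
  define B where "B = B0 + 1"
  have "1 / sqrt (1 + B\<^sup>2) > 0" by (auto intro: add_pos_nonneg)
  then obtain N where N: "\<And>m n w. m \<ge> N \<Longrightarrow> n \<ge> N \<Longrightarrow> w \<in> cball z r \<Longrightarrow>
      chordal (poly (g (s m)) w) (poly (g (s n)) w) < 1 / sqrt (1 + B\<^sup>2)"
    using unif_chordal_cauchy_onD[OF c] by (metis comp_apply)
  have "isCont (poly (g (s N))) z" by simp
  then obtain d where d: "d > 0" "\<And>w. dist w z < d \<Longrightarrow> dist (poly (g (s N)) w) (poly (g (s N)) z) < 1"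
    unfolding continuous_at_eps_delta by (metis zero_less_one)
  have "eventually (\<lambda>n. inverse (real (Suc n)) < min r d) sequentially"
    using order_tendstoD(2)[OF LIMSEQ_inverse_real_of_nat, of "min r d"] r(1) d(1) by simp
  then obtain M where M: "\<And>n. n \<ge> M \<Longrightarrow> inverse (real (Suc n)) < min r d"
    unfolding eventually_sequentially by blast
  obtain k where k: "4 * B + 4 \<le> real k" using real_arch_simple by blast
  define m where "m = max N (max M k)"
  have m: "m \<ge> N" "m \<ge> M" "real m \<ge> 4 * B + 4"
    using k by (auto simp: m_def)
  have sm: "s m \<ge> m" using s(1) by (rule strict_mono_imp_increasing)
  define v where "v = w (s m)"
  have "dist z v < inverse (real (Suc (s m)))" using w[of "s m"] by (simp add: v_def)
  moreover have "inverse (real (Suc (s m))) < min r d" using M sm m(2) by simp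
  ultimately have v: "dist v z < r" "dist v z < d" by (auto simp: dist_commute)
  have "cmod (poly (g (s N)) v) \<le> B"
  proof -
    have "dist (poly (g (s N)) v) (poly (g (s N)) z) < 1" using d(2) v(2) by blast
    then have "cmod (poly (g (s N)) v - poly (g (s N)) z) < 1" by (simp add: dist_norm)
    then show ?thesis
      using B0[OF g[of "s N"]] norm_triangle_ineq2[of "poly (g (s N)) v" "poly (g (s N)) z"] unfolding B_def by linarith
  qed
  moreover have "chordal (poly (g (s m)) v) (poly (g (s N)) v) < 1 / sqrt (1 + B\<^sup>2)"
    using N m(1) v(1) by (simp add: dist_commute)
  ultimately have "cmod (poly (g (s m)) v) \<le> 4 * B + 4"
    using chordal_less_imp_bounded by blast
  moreover have "\<not> cmod (poly (g (s m)) v) \<le> real (s m)" using big v_def by simp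
  ultimately show False using m(3) of_nat_mono[OF sm, where 'a=real] by linarith
qed

text \<open>A Fatou point with bounded orbit has a neighbourhood of points with uniformly bounded
  orbits, so it is interior to \<open>Khat G\<close>.\<close>

lemma frontier_Khat_subset_Julia:
  assumes "closed (Khat G)"
  shows "frontier (Khat G) \<subseteq> Julia G"
proof
  fix z assume z: "z \<in> frontier (Khat G)"
  show "z \<in> Julia G"
    unfolding Julia_def
  proof
    assume "z \<in> Fatou G"
    moreover have "z \<in> Khat G" using z assms frontier_subset_closed by blast
    then have "bounded {poly g z | g. g \<in> G}" by (simp add: Khat_def)
    ultimately obtain r B where rB: "r > 0" "\<And>g w. g \<in> G \<Longrightarrow> w \<in> ball z r \<Longrightarrow> cmod (poly g w) \<le> B"
      using Fatou_imp_locally_bounded by blast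
    have "ball z r \<subseteq> Khat G"
      unfolding Khat_def bounded_iff using rB(2) by blast
    then have "z \<in> interior (Khat G)" using rB(1) by (meson centre_in_ball interiorI open_ball)
    then show False using z by (simp add: frontier_def)
  qed
qed

subsection \<open>Filled Julia sets\<close>

lemma poly_escape:
  fixes g :: "complex poly"
  assumes "degree g \<ge> 2"
  obtains R where "R > 0" "\<And>z. cmod z \<ge> R \<Longrightarrow> 2 * cmod z \<le> cmod (poly g z)"
proof -
  obtain a p where g: "g = pCons a p" by (cases g)
  obtain b q where p: "p = pCons b q" by (cases p)
  \<comment> \<open>Writing \<open>g\<close> as \<open>a + z * p(z)\<close>, degree at least 2 makes
    \<open>p\<close> nonconstant. Hence \<open>|p| \<ge> 3\<close> far out, and once
    \<open>|a| \<le> |z|\<close> a factor 2 survives.\<close>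
  have "q \<noteq> 0" using assms g p by (auto split: if_splits)
  then obtain r where r: "\<And>z. r \<le> cmod z \<Longrightarrow> 3 \<le> cmod (poly p z)"
    using poly_infinity[of q 3 b] p by blast
  have "2 * cmod z \<le> cmod (poly g z)" if "cmod z \<ge> max 1 (max r (cmod a))" for z
  proof -
    have "3 * cmod z \<le> cmod (z * poly p z)"
      using r[of z] that mult_left_mono[of 3 "cmod (poly p z)" "cmod z"] by (simp add: norm_mult mult.commute)
    then show ?thesis
      using norm_triangle_ineq2[of "z * poly p z" "- a"] that unfolding g by (simp add: add.commute)
  qed
  then show ?thesis using that[of "max 1 (max r (cmod a))"] by simp
qed

lemma escape_funpow:
  fixes f :: "complex \<Rightarrow> complex"
  assumes R: "R > 0" "\<And>z. cmod z \<ge> R \<Longrightarrow> 2 * cmod z \<le> cmod (f z)" and z: "cmod z \<ge> R"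
  shows "2 ^ n * cmod z \<le> cmod ((f ^^ n) z)"
proof (induction n)
  case (Suc n)
  have "1 * cmod z \<le> 2 ^ n * cmod z" by (intro mult_right_mono) auto
  then have "cmod ((f ^^ n) z) \<ge> R" using z Suc by linarith
  from R(2)[OF this] show ?case using Suc by simp
qed simp

text \<open>Index \<open>n\<close> stands for the iterate of order \<open>n + 1\<close>: the
  semigroup need not contain the identity.\<close>

definition poly_iter :: "complex poly \<Rightarrow> nat \<Rightarrow> complex poly" where
  "poly_iter g n = (pcompose g ^^ n) g"

lemma poly_poly_iter: "poly (poly_iter g n) = poly g ^^ Suc n"
proof (induction n)
  case (Suc n)
  then show ?case by (simp add: poly_iter_def poly_pcompose_fun)
qed (simp add: poly_iter_def fun_eq_iff)

lemma poly_poly_iter_Suc: "poly (poly_iter g (Suc n)) z = poly g (poly (poly_iter g n) z)"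
  by (simp add: poly_poly_iter)

locale polynomial_semigroup =
  fixes G :: "complex poly set"
  assumes pcompose_closed: "p \<in> G \<Longrightarrow> q \<in> G \<Longrightarrow> pcompose p q \<in> G"
    and degree_ge_2: "p \<in> G \<Longrightarrow> degree p \<ge> 2"
    and nonempty: "G \<noteq> {}"
begin

lemma degree_pos: "p \<in> G \<Longrightarrow> degree p > 0"
  using degree_ge_2 by force

lemma poly_iter_in: "g \<in> G \<Longrightarrow> poly_iter g n \<in> G"
  by (induction n) (auto simp: poly_iter_def pcompose_closed)

lemma Julia_backward: "h \<in> G \<Longrightarrow> poly h z \<in> Julia G \<Longrightarrow> z \<in> Julia G"
  using Fatou_image[of G h z] pcompose_closed degree_pos by (auto simp: Julia_def)

lemma Khat_subset_cball:
  assumes g: "g \<in> G" and R: "R > 0" "\<And>z. cmod z \<ge> R \<Longrightarrow> 2 * cmod z \<le> cmod (poly g z)"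
  shows "Khat G \<subseteq> cball 0 R"
proof
  fix z assume "z \<in> Khat G"
  then obtain B where B: "\<And>h. h \<in> G \<Longrightarrow> cmod (poly h z) \<le> B"
    by (auto simp: Khat_def bounded_iff)
  show "z \<in> cball 0 R"
  proof (rule ccontr)
    assume "z \<notin> cball 0 R"
    then have z: "cmod z \<ge> R" "cmod z > 0" using R(1) by auto
    obtain n where n: "B / cmod z < real n" using reals_Archimedean2 by blast
    have "real n < 2 ^ Suc n" using of_nat_less_two_power[of "Suc n", where 'a=real] by simp
    then have "real n * cmod z \<le> 2 ^ Suc n * cmod z"
      by (intro mult_right_mono) auto
    moreover have "B < real n * cmod z" using n z(2) by (simp add: pos_divide_less_eq)
    ultimately have "B < 2 ^ Suc n * cmod z" by linarith
    also have "\<dots> \<le> cmod ((poly g ^^ Suc n) z)" by (rule escape_funpow[OF R z(1)])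
    also have "\<dots> \<le> B" using B[OF poly_iter_in[OF g, of n]] by (simp add: poly_poly_iter)
    finally show False by simp
  qed
qed

lemma Khat_forward: "h \<in> G \<Longrightarrow> z \<in> Khat G \<Longrightarrow> poly h z \<in> Khat G"
proof -
  assume "h \<in> G" "z \<in> Khat G"
  then have "{poly g (poly h z) | g. g \<in> G} \<subseteq> {poly g z | g. g \<in> G}"
    using pcompose_closed by (force simp flip: poly_pcompose)
  then show ?thesis
    using \<open>z \<in> Khat G\<close> unfolding Khat_def by (auto intro: bounded_subset)
qed

lemma bounded_forward_invariant_subset_Khat:
  assumes "bounded S" "\<And>g. g \<in> G \<Longrightarrow> poly g ` S \<subseteq> S"
  shows "S \<subseteq> Khat G"
proof
  fix z assume "z \<in> S"
  then have "{poly g z | g. g \<in> G} \<subseteq> S" using assms(2) by blast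
  then show "z \<in> Khat G" using assms(1) by (auto simp: Khat_def intro: bounded_subset)
qed

text \<open>Forward invariance makes boundedness uniform: \<open>Khat G\<close> lies in an escape
  disc, so all images of its points lie in that same disc. This exhibits \<open>Khat G\<close> as an
  intersection of closed sets.\<close>

lemma Khat_eq_Inter:
  obtains R where "R > 0" "Khat G \<subseteq> cball 0 R" "Khat G = (\<Inter>g\<in>G. poly g -` cball 0 R)"
proof -
  obtain g where g: "g \<in> G" using nonempty by blast
  obtain R where R: "R > 0" "\<And>z. cmod z \<ge> R \<Longrightarrow> 2 * cmod z \<le> cmod (poly g z)"
    using poly_escape[OF degree_ge_2[OF g]] by blast
  have sub: "Khat G \<subseteq> cball 0 R" by (rule Khat_subset_cball[OF g R])
  moreover have "Khat G = (\<Inter>g\<in>G. poly g -` cball 0 R)"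
  proof (rule subset_antisym)
    show "Khat G \<subseteq> (\<Inter>g\<in>G. poly g -` cball 0 R)"
      using sub Khat_forward by blast
    show "(\<Inter>g\<in>G. poly g -` cball 0 R) \<subseteq> Khat G"
    proof
      fix z assume "z \<in> (\<Inter>g\<in>G. poly g -` cball 0 R)"
      then have "\<forall>x \<in> {poly g z | g. g \<in> G}. cmod x \<le> R" by auto
      then show "z \<in> Khat G" unfolding Khat_def bounded_iff by blast
    qed
  qed
  ultimately show thesis using that R(1) by blast
qed

lemma closed_Khat: "closed (Khat G)"
proof -
  obtain R where "Khat G = (\<Inter>g\<in>G. poly g -` cball 0 R)" using Khat_eq_Inter by metis
  then show ?thesis by (auto intro!: closed_INT closed_poly_vimage)
qed

lemma bounded_Khat: "bounded (Khat G)"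
  using Khat_eq_Inter by (metis bounded_cball bounded_subset)

lemma compact_Khat: "compact (Khat G)"
  by (simp add: compact_eq_bounded_closed closed_Khat bounded_Khat)

text \<open>By the maximum principle the bound \<open>R\<close> on the frontier of a bounded
  complementary component holds inside it for every element of \<open>G\<close>.\<close>

lemma connected_Compl_Khat: "connected (- Khat G)"
proof (rule ccontr)
  assume "\<not> ?thesis"
  then obtain U where U: "U \<in> components (- Khat G)" and bU: "bounded U"
    using cobounded_has_bounded_component[of "- Khat G"] bounded_Khat by auto
  obtain R where R: "Khat G = (\<Inter>g\<in>G. poly g -` cball 0 R)" using Khat_eq_Inter by metis
  have fr: "frontier U \<subseteq> Khat G"
    using frontier_of_components_closed_complement[OF closed_Khat U] .
  have "U \<subseteq> Khat G"
  proof
    fix z assume z: "z \<in> U"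
    have "cmod (poly g z) \<le> R" if g: "g \<in> G" for g
    proof (rule maximum_modulus_frontier[OF _ _ bU _ z])
      show "cmod (poly g w) \<le> R" if "w \<in> frontier U" for w
        using that fr R g by auto
    qed (auto intro: holomorphic_on_poly_self continuous_on_poly_self)
    then show "z \<in> Khat G" unfolding R by auto
  qed
  then show False
    using in_components_nonempty[OF U] in_components_subset[OF U] by blast
qed

lemma interior_Khat_subset_Fatou: "interior (Khat G) \<subseteq> Fatou G"
proof
  fix z assume z: "z \<in> interior (Khat G)"
  obtain R where R: "R > 0" "Khat G \<subseteq> cball 0 R" using Khat_eq_Inter by metis
  \<comment> \<open>Two points outside the disc containing \<open>Khat G\<close>, to serve as
    omitted values for Montel's theorem.\<close>
  define a where "a = complex_of_real (R + 1)"
  define b where "b = complex_of_real (R + 2)"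
  have out: "a \<notin> Khat G" "b \<notin> Khat G" "a \<noteq> b"
    using R by (auto simp: a_def b_def norm_of_real simp del: of_real_add dest!: subsetD)
  show "z \<in> Fatou G"
  proof (rule Fatou_if_omits[OF open_interior z out(3)])
    fix h w assume "h \<in> G" "w \<in> interior (Khat G)"
    then have "poly h w \<in> Khat G" using Khat_forward interior_subset by blast
    then show "poly h w \<noteq> a \<and> poly h w \<noteq> b" using out by blast
  qed
qed

end

section \<open>The filled Julia set of a single polynomial\<close>

definition filled :: "complex poly \<Rightarrow> complex set" where
  "filled g = Khat (poly_semigroup {g})"

lemma poly_semigroup_degree_ge_2:
  assumes "p \<in> poly_semigroup S" "\<And>q. q \<in> S \<Longrightarrow> degree q \<ge> 2"
  shows "degree p \<ge> 2"
  using assms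
proof (induction rule: poly_semigroup.induct)
  case (comp p q)
  then have "2 * 1 \<le> degree p * degree q" by (intro mult_le_mono) auto
  then show ?case by (simp add: degree_pcompose)
qed auto

lemma polynomial_semigroup_single:
  assumes "degree g \<ge> 2"
  shows "polynomial_semigroup (poly_semigroup {g})"
proof
  show "degree p \<ge> 2" if "p \<in> poly_semigroup {g}" for p
    using poly_semigroup_degree_ge_2[OF that] assms by auto
qed (auto intro: poly_semigroup.intros)

lemma poly_semigroup_single_cases:
  assumes "p \<in> poly_semigroup {g}"
  obtains n where "poly p = poly g ^^ Suc n"
proof -
  have "\<exists>n. poly p = poly g ^^ Suc n"
    using assms
  proof (induction rule: poly_semigroup.induct)
    case (gen p)
    then show ?case by (intro exI[of _ 0]) (simp add: fun_eq_iff)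
  next
    case (comp p q)
    then obtain m n where mn: "poly p = poly g ^^ Suc m" "poly q = poly g ^^ Suc n" by blast
    have "poly (pcompose p q) = poly g ^^ (Suc m + Suc n)"
      by (simp only: poly_pcompose_fun mn funpow_add)
    then show ?case by (intro exI[of _ "m + Suc n"]) simp
  qed
  then show thesis using that by blast
qed

lemma filled_iff: "z \<in> filled g \<longleftrightarrow> bounded (range (\<lambda>n. (poly g ^^ Suc n) z))"
proof -
  have "{poly p z | p. p \<in> poly_semigroup {g}} = range (\<lambda>n. (poly g ^^ Suc n) z)"
  proof (intro subset_antisym subsetI)
    fix w assume "w \<in> {poly p z | p. p \<in> poly_semigroup {g}}"
    then show "w \<in> range (\<lambda>n. (poly g ^^ Suc n) z)"
      by (auto elim!: poly_semigroup_single_cases)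
  next
    fix w assume "w \<in> range (\<lambda>n. (poly g ^^ Suc n) z)"
    then obtain n where n: "w = poly (poly_iter g n) z" by (auto simp: poly_poly_iter)
    have "poly_iter g n \<in> poly_semigroup {g}"
      by (induction n) (auto simp: poly_iter_def intro: poly_semigroup.intros)
    then show "w \<in> {poly p z | p. p \<in> poly_semigroup {g}}" using n by blast
  qed
  then show ?thesis by (simp add: filled_def Khat_def)
qed

lemma vimage_filled: "poly g -` filled g = filled g"
proof (intro subset_antisym subsetI)
  fix z assume "z \<in> poly g -` filled g"
  then have b: "bounded (insert (poly g z) (range (\<lambda>n. (poly g ^^ Suc n) (poly g z))))"
    by (simp add: filled_iff)
  have "range (\<lambda>n. (poly g ^^ Suc n) z) \<subseteq> insert (poly g z) (range (\<lambda>n. (poly g ^^ Suc n) (poly g z)))"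
  proof
    fix w assume "w \<in> range (\<lambda>n. (poly g ^^ Suc n) z)"
    then obtain n where n: "w = (poly g ^^ Suc n) z" by blast
    show "w \<in> insert (poly g z) (range (\<lambda>n. (poly g ^^ Suc n) (poly g z)))"
    proof (cases n)
      case (Suc m)
      then have "w = (poly g ^^ Suc m) (poly g z)" using n by (simp add: funpow_swap1)
      then show ?thesis by blast
    qed (use n in simp)
  qed
  then show "z \<in> filled g"
    unfolding filled_iff using b bounded_subset by blast
next
  fix z assume "z \<in> filled g"
  then have b: "bounded (range (\<lambda>n. (poly g ^^ Suc n) z))" by (simp add: filled_iff)
  have *: "(poly g ^^ Suc n) (poly g z) = (poly g ^^ Suc (Suc n)) z" for n
    by (simp add: funpow_swap1)
  then have "range (\<lambda>n. (poly g ^^ Suc n) (poly g z)) \<subseteq> range (\<lambda>n. (poly g ^^ Suc n) z)"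
    by (intro image_subsetI) (simp only: *, rule rangeI)
  then show "z \<in> poly g -` filled g"
    using bounded_subset[OF b] by (simp add: filled_iff)
qed

text \<open>For a continuous open map, taking preimages commutes with interiors, and frontiers are
  expressed through interiors.\<close>

lemma frontier_poly_vimage:
  fixes f :: "complex poly"
  assumes f: "degree f > 0"
  shows "frontier (poly f -` S) = poly f -` frontier S"
proof -
  have int: "interior (poly f -` T) = poly f -` interior T" for T
  proof (rule subset_antisym)
    have "poly f ` interior (poly f -` T) \<subseteq> interior T"
      using open_poly_image[OF f open_interior] interior_subset by (intro interior_maximal) blast+
    then show "interior (poly f -` T) \<subseteq> poly f -` interior T" by blast
    show "poly f -` interior T \<subseteq> interior (poly f -` T)"
      using interior_subset by (intro interior_maximal open_vimage continuous_on_poly_self) blast+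
  qed
  have "frontier T = - (interior T \<union> interior (- T))" for T :: "complex set"
    by (auto simp: frontier_def closure_interior)
  then show ?thesis by (simp add: int flip: vimage_Compl)
qed

lemma vimage_frontier_filled: "degree g > 0 \<Longrightarrow> poly g -` frontier (filled g) = frontier (filled g)"
  using frontier_poly_vimage[of g "filled g"] vimage_filled[of g] by simp

lemma Compl_filled_forward: "z \<notin> filled g \<Longrightarrow> poly g z \<notin> filled g"
  using vimage_filled by blast

text \<open>The complement of the filled Julia set is forward invariant, so there the iterates omit
  \<open>a\<close> and \<open>b\<close> and Montel's theorem applies. The interior lies in the Fatou
  set as well.\<close>

lemma Julia1_eq_frontier_filled:
  assumes g: "degree g \<ge> 2" and ab: "a \<in> filled g" "b \<in> filled g" "a \<noteq> b"
  shows "Julia1 g = frontier (filled g)"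
proof (rule subset_antisym)
  interpret polynomial_semigroup "poly_semigroup {g}" by (rule polynomial_semigroup_single[OF g])
  show "frontier (filled g) \<subseteq> Julia1 g"
    unfolding filled_def Julia1_def by (rule frontier_Khat_subset_Julia[OF closed_Khat])
  have "z \<in> Fatou (poly_semigroup {g})" if z: "z \<in> - filled g" for z
  proof (rule Fatou_if_omits[OF _ z ab(3)])
    show "open (- filled g)" using closed_Khat by (simp add: filled_def open_Compl)
    fix h w assume h: "h \<in> poly_semigroup {g}" and w: "w \<in> - filled g"
    obtain n where n: "poly h = poly g ^^ Suc n" using h by (rule poly_semigroup_single_cases)
    have "(poly g ^^ k) w \<notin> filled g" for k
      using w by (induction k) (auto simp: Compl_filled_forward)
    then have "poly h w \<notin> filled g" using n by metis
    then show "poly h w \<noteq> a \<and> poly h w \<noteq> b" using ab by blast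
  qed
  then show "Julia1 g \<subseteq> frontier (filled g)"
    using interior_Khat_subset_Fatou closed_Khat
    by (auto simp: frontier_def Julia1_def Julia_def filled_def)
qed

text \<open>The complement of \<open>L\<close> is connected and unbounded and avoids the frontier of
  \<open>K\<close>; if it met \<open>K\<close> it would lie inside the bounded set
  \<open>K\<close>.\<close>

lemma subset_interior_if_frontier_subset_interior:
  fixes K L :: "complex set"
  assumes "bounded K" "bounded L" "connected (- L)" "frontier K \<subseteq> interior L"
  shows "K \<subseteq> interior L"
proof -
  have "K \<subseteq> L"
  proof (rule ccontr)
    assume "\<not> K \<subseteq> L"
    then have "- L \<inter> K \<noteq> {}" by blast
    moreover have "- L \<inter> frontier K = {}" using assms(4) interior_subset by blast
    ultimately have "- L \<subseteq> K" using connected_Int_frontier[OF assms(3)] by blast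
    then show False
      using assms(1,2) bounded_subset cobounded_imp_unbounded by blast
  qed
  then have "interior K \<subseteq> interior L" by (rule interior_mono)
  moreover have "K \<subseteq> interior K \<union> frontier K"
    using closure_subset by (auto simp: frontier_def)
  ultimately show ?thesis using assms(4) by blast
qed

lemma connected_subset_interior:
  assumes "connected A" "A \<inter> frontier K = {}" "A \<inter> K \<noteq> {}"
  shows "A \<subseteq> interior K"
proof -
  have "A \<subseteq> K" using connected_Int_frontier[OF assms(1,3)] assms(2) by blast
  moreover have "K \<subseteq> interior K \<union> frontier K"
    using closure_subset by (auto simp: frontier_def)
  ultimately show ?thesis using assms(2) by blast
qed

lemma poly_semigroup_single_subset:
  assumes "\<And>p q. p \<in> G \<Longrightarrow> q \<in> G \<Longrightarrow> pcompose p q \<in> G" "g \<in> G"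
  shows "poly_semigroup {g} \<subseteq> G"
proof
  fix p assume "p \<in> poly_semigroup {g}"
  then show "p \<in> G" by (induction rule: poly_semigroup.induct) (use assms in auto)
qed

section \<open>Semigroups with bounded postcritical set: connectedness of filled Julia sets\<close>

locale postcritically_bounded = polynomial_semigroup +
  assumes bounded_Pstar: "bounded (Pstar G)"
begin

lemma critical_value_in_Pstar: "g \<in> G \<Longrightarrow> poly (pderiv g) c = 0 \<Longrightarrow> poly g c \<in> Pstar G"
  unfolding Pstar_def by (rule subsetD[OF closure_subset]) blast

text \<open>By the chain rule, the image of a critical value of \<open>g\<close> under
  \<open>h\<close> is a critical value of \<open>h \<circ> g\<close>, so its whole orbit stays in
  the bounded set \<open>Pstar G\<close>.\<close>

lemma critical_value_in_Khat:
  assumes "g \<in> G" "poly (pderiv g) c = 0"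
  shows "poly g c \<in> Khat G"
proof -
  have "poly h (poly g c) \<in> Pstar G" if h: "h \<in> G" for h
    using critical_value_in_Pstar[OF pcompose_closed[OF h assms(1)], of c] assms(2)
    by (simp add: pderiv_pcompose poly_pcompose)
  then have "{poly h (poly g c) | h. h \<in> G} \<subseteq> Pstar G" by blast
  then show ?thesis unfolding Khat_def using bounded_Pstar bounded_subset by blast
qed

lemma critical_point_exists:
  assumes "g \<in> G"
  obtains c where "poly (pderiv g) c = 0"
proof -
  have "degree (pderiv g) \<noteq> 0" using degree_ge_2[OF assms] by (simp add: degree_pderiv)
  then have "\<not> constant (poly (pderiv g))" by (simp add: constant_degree)
  then show thesis using fundamental_theorem_of_algebra that by blast
qed

lemma Khat_nonempty: "Khat G \<noteq> {}"
  using nonempty critical_point_exists critical_value_in_Khat by blast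

lemma Khat_subset_filled: "g \<in> G \<Longrightarrow> Khat G \<subseteq> filled g"
proof
  fix z assume g: "g \<in> G" and "z \<in> Khat G"
  then have "bounded {poly p z | p. p \<in> G}" by (simp add: Khat_def)
  moreover have "{poly p z | p. p \<in> poly_semigroup {g}} \<subseteq> {poly p z | p. p \<in> G}"
    using poly_semigroup_single_subset[OF pcompose_closed g] by blast
  ultimately show "z \<in> filled g" unfolding filled_def Khat_def using bounded_subset by blast
qed

lemma Julia1_subset_Julia: "g \<in> G \<Longrightarrow> Julia1 g \<subseteq> Julia G"
  unfolding Julia1_def using poly_semigroup_single_subset[OF pcompose_closed] by (intro Julia_mono) blast

lemma single: "g \<in> G \<Longrightarrow> polynomial_semigroup (poly_semigroup {g})"
  using polynomial_semigroup_single degree_ge_2 by blast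

lemma compact_filled: "g \<in> G \<Longrightarrow> compact (filled g)"
  unfolding filled_def using polynomial_semigroup.compact_Khat[OF single] .

lemma bounded_filled: "g \<in> G \<Longrightarrow> bounded (filled g)"
  using compact_filled compact_imp_bounded by blast

lemma connected_Compl_filled: "g \<in> G \<Longrightarrow> connected (- filled g)"
  unfolding filled_def using polynomial_semigroup.connected_Compl_Khat[OF single] .

text \<open>A filled Julia set reduced to one point would consist of a superattracting fixed point.\<close>

lemma filled_two_points:
  assumes g: "g \<in> G"
  obtains a b where "a \<in> filled g" "b \<in> filled g" "a \<noteq> b"
proof (rule ccontr)
  assume no: "\<not> thesis"
  note witness = that
  obtain c where c: "poly (pderiv g) c = 0" using critical_point_exists[OF g] .
  have gc: "poly g c \<in> filled g" using critical_value_in_Khat[OF g c] Khat_subset_filled[OF g] by blast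
  then have cK: "c \<in> filled g" using vimage_filled by blast
  have single_point: "z = c" if "z \<in> filled g" for z
    using no witness[OF that cK] by blast
  have fix_c: "poly g c = c" using single_point[OF gc] .
  \<comment> \<open>The difference quotient at \<open>c\<close> tends to 0, so a small disc around
    the fixed point is mapped into itself and belongs to the filled Julia set.\<close>
  have "(poly g has_field_derivative 0) (at c)" using poly_DERIV[of g c] c by simp
  then have "(\<lambda>z. (poly g z - poly g c) / (z - c)) \<midarrow>c\<rightarrow> 0"
    by (simp add: has_field_derivative_iff)
  then obtain d where d: "d > 0" "\<And>z. z \<noteq> c \<Longrightarrow> cmod (z - c) < d \<Longrightarrow> cmod ((poly g z - poly g c) / (z - c) - 0) < 1"
    unfolding LIM_eq by (metis zero_less_one)
  have contr: "poly g z \<in> ball c d" if z: "z \<in> ball c d" for z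
  proof (cases "z = c")
    case False
    moreover have dz: "cmod (z - c) < d" using z by (simp add: dist_norm norm_minus_commute)
    ultimately have "cmod (poly g z - c) / cmod (z - c) < 1"
      using d(2)[of z] fix_c by (simp add: norm_divide)
    then have "cmod (poly g z - c) < cmod (z - c)" using False by (simp add: divide_less_eq)
    then show ?thesis using dz by (simp add: dist_norm norm_minus_commute)
  qed (use fix_c z in auto)
  have iter: "(poly g ^^ n) z \<in> ball c d" if "z \<in> ball c d" for n z
    using that contr by (induction n) auto
  have "z \<in> filled g" if "z \<in> ball c d" for z
    unfolding filled_iff by (rule bounded_subset[OF bounded_ball[of c d]]) (intro image_subsetI iter[OF that])
  then have "ball c d \<subseteq> filled g" by blast
  moreover have "c + of_real (d / 2) \<in> ball c d" using d(1) by (simp add: dist_norm norm_of_real)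
  ultimately have "c + of_real (d / 2) = c" using single_point by blast
  then show False using d(1) by simp
qed

lemma Julia1_eq: "g \<in> G \<Longrightarrow> Julia1 g = frontier (filled g)"
  using filled_two_points Julia1_eq_frontier_filled degree_ge_2 by metis

lemma Julia1_nonempty:
  assumes g: "g \<in> G"
  shows "Julia1 g \<noteq> {}"
proof -
  have "filled g \<noteq> {}" using filled_two_points[OF g] by blast
  moreover have "filled g \<noteq> UNIV" using bounded_filled[OF g] not_bounded_UNIV by metis
  ultimately show ?thesis by (simp add: Julia1_eq[OF g] frontier_eq_empty)
qed

lemma Julia1_subset_filled: "g \<in> G \<Longrightarrow> Julia1 g \<subseteq> filled g"
  using Julia1_eq frontier_subset_closed compact_filled compact_imp_closed by metis

text \<open>The preimage is the intersection of the sets \<open>|h n| \<le> R\<close> with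
  \<open>h n\<close> equal to \<open>g^(n+1) \<circ> f\<close>. As \<open>h n\<close> lies in
  \<open>G\<close>, its critical values lie in \<open>Pstar G\<close>, so every such set is
  connected. With \<open>f = g\<close> the filled Julia set itself is connected.\<close>

lemma vimage_filled_connected:
  assumes f: "f \<in> G" and g: "g \<in> G"
  shows "connected (poly f -` filled g)"
proof -
  obtain R0 where R0: "R0 > 0" "\<And>z. cmod z \<ge> R0 \<Longrightarrow> 2 * cmod z \<le> cmod (poly g z)"
    using poly_escape[OF degree_ge_2[OF g]] by blast
  obtain P where P: "\<And>z. z \<in> Pstar G \<Longrightarrow> cmod z \<le> P" using bounded_Pstar by (auto simp: bounded_iff)
  define R where "R = max R0 P"
  have R: "R > 0" "\<And>z. cmod z \<ge> R \<Longrightarrow> 2 * cmod z \<le> cmod (poly g z)" using R0 by (auto simp: R_def)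
  have sub: "filled g \<subseteq> cball 0 R"
    unfolding filled_def
    by (rule polynomial_semigroup.Khat_subset_cball[OF single[OF g] _ R]) (auto intro: poly_semigroup.gen)
  define h where "h n = pcompose (poly_iter g n) f" for n
  have hG: "h n \<in> G" for n using f g by (simp add: h_def pcompose_closed poly_iter_in)
  have "poly f -` filled g = (\<Inter>n. {z. cmod (poly (h n) z) \<le> R})"
  proof (intro subset_antisym subsetI)
    fix z assume "z \<in> poly f -` filled g"
    then have "(poly g ^^ n) (poly f z) \<in> filled g" for n
      using vimage_filled[of g] by (induction n) auto
    then have "poly (poly_iter g n) (poly f z) \<in> cball 0 R" for n
      using sub poly_poly_iter by (metis subsetD)
    then show "z \<in> (\<Inter>n. {z. cmod (poly (h n) z) \<le> R})" by (simp add: h_def poly_pcompose)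
  next
    fix z assume z: "z \<in> (\<Inter>n. {z. cmod (poly (h n) z) \<le> R})"
    have "cmod ((poly g ^^ Suc n) (poly f z)) \<le> R" for n
      using z unfolding h_def poly_pcompose poly_poly_iter by blast
    then show "z \<in> poly f -` filled g" by (auto simp: filled_iff bounded_iff simp del: funpow.simps)
  qed
  also have "connected \<dots>"
  proof (rule connected_nest)
    fix n
    have "{z. cmod (poly (h n) z) \<le> R} = poly (h n) -` cball 0 R" by auto
    then show "compact {z. cmod (poly (h n) z) \<le> R}"
      using compact_poly_vimage[OF degree_pos[OF hG]] by (metis compact_cball)
    have "cmod (poly (h n) c) \<le> R" if "poly (pderiv (h n)) c = 0" for c
      using P[OF critical_value_in_Pstar[OF hG that]] by (simp add: R_def)
    then show "connected {z. cmod (poly (h n) z) \<le> R}"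
      using connected_poly_sublevel[OF degree_pos[OF hG]] R(1) by simp
  next
    have step: "{z. cmod (poly (h (Suc n)) z) \<le> R} \<subseteq> {z. cmod (poly (h n) z) \<le> R}" for n
    proof
      fix z assume "z \<in> {z. cmod (poly (h (Suc n)) z) \<le> R}"
      then have "cmod (poly g (poly (h n) z)) \<le> R" by (simp add: h_def poly_pcompose poly_poly_iter_Suc)
      then have "cmod (poly (h n) z) \<le> R"
        using R(2)[of "poly (h n) z"] R(1) by (cases "cmod (poly (h n) z) \<ge> R") linarith+
      then show "z \<in> {z. cmod (poly (h n) z) \<le> R}" by simp
    qed
    show "{z. cmod (poly (h n) z) \<le> R} \<subseteq> {z. cmod (poly (h m) z) \<le> R}" if "m \<le> n" for m n
      using that step by (rule lift_Suc_antimono_le[rotated])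
  qed
  finally show ?thesis .
qed

lemma connected_filled: "g \<in> G \<Longrightarrow> connected (filled g)"
  using vimage_filled_connected[of g g] vimage_filled[of g] by simp

text \<open>The preimage of the filled Julia set is a continuum with connected complement, so its
  frontier is connected; that frontier is the preimage of \<open>Julia1 g\<close>.\<close>

lemma connected_vimage_Julia1:
  assumes f: "f \<in> G" and g: "g \<in> G"
  shows "connected (poly f -` Julia1 g)"
  using connected_frontier_simple[OF vimage_filled_connected[OF f g]]
    connected_Compl_poly_vimage[OF degree_pos[OF f] compact_filled[OF g] connected_Compl_filled[OF g]]
  by (simp add: frontier_poly_vimage degree_pos f Julia1_eq[OF g])

lemma vimage_Julia1: "g \<in> G \<Longrightarrow> poly g -` Julia1 g = Julia1 g"
  using vimage_frontier_filled degree_pos Julia1_eq by metis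

lemma connected_Julia1: "g \<in> G \<Longrightarrow> connected (Julia1 g)"
  using connected_vimage_Julia1[of g g] vimage_Julia1[of g] by simp

section \<open>Nesting of Julia components and forward invariance of their holes\<close>

lemma Julia_component_comparable:
  assumes f: "f \<in> G" and g: "g \<in> G" and C: "C \<in> components (Julia G)" "Julia1 f \<subseteq> C"
    and D: "D \<in> components (Julia G)" "Julia1 g \<subseteq> D" and "C \<noteq> D"
  shows "C \<subseteq> interior (filled g) \<or> D \<subseteq> interior (filled f)"
proof -
  have disj: "C \<inter> D = {}" using components_nonoverlap[OF C(1) D(1)] \<open>C \<noteq> D\<close> by simp
  have sub: "C' \<subseteq> interior (filled h)"
    if C': "C' \<in> components (Julia G)" "Julia1 k \<subseteq> C'" "C' \<inter> Julia1 h = {}"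
      "Julia1 k \<inter> filled h \<noteq> {}" and "h \<in> G" for C' h k
    using that in_components_connected[OF C'(1)] Julia1_eq by (intro connected_subset_interior) auto
  show ?thesis
  \<comment> \<open>If \<open>J(f)\<close> meets \<open>K(g)\<close>, then \<open>C\<close> meets
    \<open>K(g)\<close> but avoids its frontier. Otherwise \<open>K(g)\<close> avoids
    \<open>J(f)\<close> and shares the points of \<open>Khat G\<close> with \<open>K(f)\<close>, so
    it lies inside \<open>K(f)\<close>, and the same argument applies to \<open>D\<close>.\<close>
  proof (cases "Julia1 f \<inter> filled g = {}")
    case False
    then show ?thesis using sub[OF C _ False g] disj D(2) by blast
  next
    case True
    have "filled g \<inter> filled f \<noteq> {}"
      using Khat_subset_filled[OF f] Khat_subset_filled[OF g] Khat_nonempty by blast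
    then have "filled g \<subseteq> interior (filled f)"
      using connected_subset_interior[OF connected_filled[OF g]] True Julia1_eq[OF f] by blast
    then have "Julia1 g \<inter> filled f \<noteq> {}"
      using Julia1_subset_filled[OF g] Julia1_nonempty[OF g] interior_subset by blast
    then show ?thesis using sub[OF D _ _ f] disj C(2) by blast
  qed
qed

text \<open>The hole of \<open>C\<close> around \<open>Khat G\<close>. It is a union of
  complementary components because \<open>Khat G\<close> is not yet known to be connected.\<close>

definition core :: "complex set \<Rightarrow> complex set" where
  "core C = \<Union> {W \<in> components (- C). W \<inter> Khat G \<noteq> {}}"

lemma connected_subset_core:
  assumes "connected A" "A \<inter> C = {}" "A \<inter> Khat G \<noteq> {}"
  shows "A \<subseteq> core C"
proof -
  obtain W where "W \<in> components (- C)" "A \<subseteq> W"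
    using exists_component_superset[of A "- C"] assms by blast
  then show ?thesis using assms(3) unfolding core_def by blast
qed

lemma open_core: "closed C \<Longrightarrow> open (core C)"
  unfolding core_def using open_components[of "- C"] by (intro open_Union) auto

lemma core_disjoint: "core C \<inter> C = {}"
  unfolding core_def using in_components_subset by blast

lemma component_subset_interior_filled:
  assumes "h \<in> G" "Julia1 h \<subseteq> C" "W \<in> components (- C)" "W \<inter> Khat G \<noteq> {}"
  shows "W \<subseteq> interior (filled h)"
  using assms in_components_connected[OF assms(3)] in_components_subset[OF assms(3)]
    Khat_subset_filled[OF assms(1)] Julia1_eq[OF assms(1)]
  by (intro connected_subset_interior) auto

lemma core_subset_interior_filled:
  "h \<in> G \<Longrightarrow> Julia1 h \<subseteq> C \<Longrightarrow> core C \<subseteq> interior (filled h)"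
  unfolding core_def using component_subset_interior_filled by blast

lemma component_vimage_through_point:
  assumes C: "C \<in> components (Julia G)" "compact C" and g: "g \<in> G" and x: "poly g x \<in> C"
  obtains E where "E \<in> components (poly g -` C)" "x \<in> E" "poly g ` E = C" "E \<subseteq> Julia G" "connected E"
proof -
  obtain E where E: "E \<in> components (poly g -` C)" "x \<in> E"
    using x Union_components[of "poly g -` C"] by blast
  have "E \<subseteq> Julia G"
    using in_components_subset[OF E(1)] in_components_subset[OF C(1)] Julia_backward[OF g] by blast
  then show thesis
    using that[OF E component_poly_vimage_surj[OF degree_pos[OF g] C(2) _ E(1)]]
      in_components_connected[OF C(1)] in_components_connected[OF E(1)] by blast
qed

text \<open>If \<open>g\<close> had a preimage of \<open>C\<close> inside the hole of \<open>C\<close>, then it would map the complement of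
  \<open>K(h)\<close>, a neighbourhood of \<open>J(g)\<close>, into itself, and Montel's theorem would make the iterates
  of \<open>g\<close> normal there.\<close>

lemma vimage_disjoint_core:
  assumes C: "C \<in> components (Julia G)" "compact C" and h: "h \<in> G" "Julia1 h \<subseteq> C"
    and g: "g \<in> G" and gC: "Julia1 g \<subseteq> C \<or> C \<subseteq> interior (filled g)"
  shows "poly g -` C \<inter> core C = {}"
proof (rule ccontr)
  assume "poly g -` C \<inter> core C \<noteq> {}"
  then obtain x where x: "poly g x \<in> C" "x \<in> core C" by blast
  obtain E where E: "E \<in> components (poly g -` C)" "x \<in> E" "poly g ` E = C" "E \<subseteq> Julia G" "connected E"
    using component_vimage_through_point[OF C g x(1)] .
  have xC: "x \<notin> C" using x(2) core_disjoint by blast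
  have EC: "E \<inter> C = {}"
  proof (rule ccontr)
    assume "E \<inter> C \<noteq> {}"
    then have "E \<subseteq> C" using components_maximal[OF C(1) E(5,4)] by blast
    then show False using E(2) xC by blast
  qed
  show False
  proof (cases "Julia1 g \<subseteq> C")
    case True
    \<comment> \<open>\<open>J(g)\<close> equals its full preimage under \<open>g\<close>. As
      \<open>E\<close> maps onto \<open>C\<close>, which contains \<open>J(g)\<close>, it would
      contain a point of \<open>J(g)\<close> and so meet \<open>C\<close>.\<close>
    obtain y where y: "y \<in> Julia1 g" using Julia1_nonempty[OF g] by blast
    then obtain e where e: "e \<in> E" "poly g e = y" using True E(3) by blast
    then have "e \<in> Julia1 g" using vimage_Julia1[OF g] y by blast
    then show False using EC True e by blast
  next
    case False
    then have CK: "C \<subseteq> interior (filled g)" using gC by blast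
    obtain W where W: "W \<in> components (- C)" "W \<inter> Khat G \<noteq> {}" "x \<in> W"
      using x(2) by (auto simp: core_def)
    have EW: "E \<subseteq> W" using components_maximal[OF W(1) E(5)] EC E(2) W(3) by blast
    obtain y where y: "y \<in> Julia1 h" using Julia1_nonempty[OF h(1)] by blast
    then obtain e where e: "e \<in> E" "poly g e = y" using h(2) E(3) by blast
    \<comment> \<open>The preimage of \<open>J(h)\<close> is connected and meets the component
      \<open>E\<close>, so \<open>E\<close> contains all of it. Thus the frontier of the preimage of
      \<open>K(h)\<close> lies inside \<open>K(h)\<close>, and then so does the preimage.\<close>
    have "poly g -` Julia1 h \<subseteq> E"
      using components_maximal[OF E(1) connected_vimage_Julia1[OF g h(1)]] h(2) e y by blast
    moreover have "frontier (poly g -` filled h) = poly g -` Julia1 h"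
      unfolding Julia1_eq[OF h(1)] by (rule frontier_poly_vimage[OF degree_pos[OF g]])
    moreover have "E \<subseteq> interior (filled h)"
      using EW component_subset_interior_filled[OF h W(1,2)] by (rule order_trans)
    ultimately have "frontier (poly g -` filled h) \<subseteq> interior (filled h)"
      by simp
    then have "poly g -` filled h \<subseteq> interior (filled h)"
      by (rule subset_interior_if_frontier_subset_interior[OF
            bounded_poly_vimage[OF degree_pos[OF g] bounded_filled[OF h(1)]]
            bounded_filled[OF h(1)] connected_Compl_filled[OF h(1)]])
    then have fwd: "poly g z \<in> - filled h" if "z \<in> - filled h" for z
      using that interior_subset by blast
    have "filled h \<subseteq> interior (filled g)"
      using CK h(2) Julia1_eq[OF h(1)]
      by (intro subset_interior_if_frontier_subset_interior[OF
            bounded_filled[OF h(1)] bounded_filled[OF g] connected_Compl_filled[OF g]]) simp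
    then have Jg: "Julia1 g \<subseteq> - filled h"
      using Julia1_eq[OF g] by (auto simp: frontier_def)
    obtain a b where ab: "a \<in> filled h" "b \<in> filled h" "a \<noteq> b" using filled_two_points[OF h(1)] .
    obtain z where z: "z \<in> Julia1 g" using Julia1_nonempty[OF g] by blast
    have "z \<in> Fatou (poly_semigroup {g})"
    proof (rule Fatou_if_omits[OF _ _ ab(3)])
      show "open (- filled h)" using compact_filled[OF h(1)] compact_imp_closed open_Compl by blast
      show "z \<in> - filled h" using z Jg by blast
      fix p w assume p: "p \<in> poly_semigroup {g}" and w: "w \<in> - filled h"
      obtain n where n: "poly p = poly g ^^ Suc n" using p by (rule poly_semigroup_single_cases)
      have "(poly g ^^ k) w \<in> - filled h" for k
        using w fwd by (induction k) auto
      then have "poly p w \<in> - filled h" using n by metis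
      then show "poly p w \<noteq> a \<and> poly p w \<noteq> b" using ab by blast
    qed
    then show False using z by (simp add: Julia1_def Julia_def)
  qed
qed

text \<open>The image of a component of the hole is connected, avoids \<open>C\<close> by the
  previous lemma, and still meets \<open>Khat G\<close>.\<close>

lemma core_forward:
  assumes C: "C \<in> components (Julia G)" "compact C" and h: "h \<in> G" "Julia1 h \<subseteq> C"
    and g: "g \<in> G" and gC: "Julia1 g \<subseteq> C \<or> C \<subseteq> interior (filled g)"
  shows "poly g ` core C \<subseteq> core C"
proof
  fix y assume "y \<in> poly g ` core C"
  then obtain x W where x: "x \<in> W" "y = poly g x" and W: "W \<in> components (- C)" "W \<inter> Khat G \<noteq> {}"
    by (auto simp: core_def)
  have "W \<subseteq> core C" using W unfolding core_def by blast
  then have "poly g ` W \<inter> C = {}" using vimage_disjoint_core[OF assms] by blast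
  moreover have "connected (poly g ` W)"
    using in_components_connected[OF W(1)] continuous_on_poly_self by (intro connected_continuous_image)
  moreover have "poly g ` W \<inter> Khat G \<noteq> {}" using W(2) Khat_forward[OF g] by blast
  ultimately have "poly g ` W \<subseteq> core C" by (intro connected_subset_core)
  then show "y \<in> core C" using x by blast
qed

end

text \<open>Disjoint open sets separating the intersection would, by compactness and directedness,
  already cover one member and meet it on both sides.\<close>

lemma connected_Inter_directed:
  fixes F :: "'a::euclidean_space set set"
  assumes ne: "F \<noteq> {}" and F: "\<And>S. S \<in> F \<Longrightarrow> compact S" "\<And>S. S \<in> F \<Longrightarrow> connected S"
    and dir: "\<And>S T. S \<in> F \<Longrightarrow> T \<in> F \<Longrightarrow> \<exists>R\<in>F. R \<subseteq> S \<inter> T"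
  shows "connected (\<Inter>F)"
proof (rule ccontr)
  assume "\<not> ?thesis"
  then obtain A B where AB: "closed A" "closed B" "\<Inter>F \<subseteq> A \<union> B" "A \<inter> B \<inter> \<Inter>F = {}"
      "A \<inter> \<Inter>F \<noteq> {}" "B \<inter> \<Inter>F \<noteq> {}"
    unfolding connected_closed by blast
  obtain S0 where S0: "S0 \<in> F" using ne by blast
  have "closed (\<Inter>F)" by (intro closed_Inter ballI compact_imp_closed F(1))
  moreover have "bounded (\<Inter>F)"
    using bounded_subset[OF compact_imp_bounded[OF F(1)[OF S0]] Inter_lower[OF S0]] .
  ultimately have "compact (A \<inter> \<Inter>F)" "closed (B \<inter> \<Inter>F)"
    using AB(1,2) by (auto simp: compact_eq_bounded_closed)
  moreover have "(A \<inter> \<Inter>F) \<inter> (B \<inter> \<Inter>F) = {}" using AB(4) by blast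
  ultimately obtain U V where UV: "open U" "open V" "A \<inter> \<Inter>F \<subseteq> U" "B \<inter> \<Inter>F \<subseteq> V" "U \<inter> V = {}"
    by (rule separation_normal_compact)
  have low: "\<exists>D\<in>F. D \<subseteq> S0 \<inter> \<Inter>F'" if "finite F'" "F' \<subseteq> F" for F'
    using that
  proof (induction rule: finite_induct)
    case (insert T F')
    then obtain D where D: "D \<in> F" "D \<subseteq> S0 \<inter> \<Inter>F'" by blast
    moreover obtain R where "R \<in> F" "R \<subseteq> D \<inter> T" using dir[OF D(1)] insert.prems by blast
    ultimately show ?case by (intro bexI[of _ R]) auto
  qed (use S0 in auto)
  have "\<exists>C\<in>F. C \<subseteq> U \<union> V"
  proof (rule ccontr)
    assume no: "\<not> ?thesis"
    have "(S0 - (U \<union> V)) \<inter> \<Inter>F \<noteq> {}"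
    proof (rule compact_imp_fip)
      show "compact (S0 - (U \<union> V))" using F(1)[OF S0] UV(1,2) by (simp add: compact_diff open_Un)
      show "closed T" if "T \<in> F" for T using F(1)[OF that] compact_imp_closed by blast
      fix F' assume "finite F'" "F' \<subseteq> F"
      then obtain D where "D \<in> F" "D \<subseteq> S0 \<inter> \<Inter>F'" using low by blast
      then show "(S0 - (U \<union> V)) \<inter> \<Inter>F' \<noteq> {}" using no by blast
    qed
    then show False using AB(3) UV(3,4) by blast
  qed
  then obtain C where C: "C \<in> F" "C \<subseteq> U \<union> V" by blast
  have "U \<inter> C \<noteq> {}" "V \<inter> C \<noteq> {}" using AB(5,6) UV(3,4) C(1) by blast+
  then show False
    using connectedD[OF F(2)[OF C(1)] UV(1,2)] C(2) UV(5) by blast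
qed

text \<open>Let \<open>V\<close> be a bounded neighbourhood of an open compact piece of the Julia set with no other
  Julia points in its closure.  By Montel's theorem some \<open>h(V)\<close> meets \<open>E\<close>; the intersection is
  open and closed in \<open>E\<close>.\<close>

lemma (in polynomial_semigroup) bounded_connected_subset_Julia:
  assumes dis: "Julia_disconnected G" and E: "connected E" "E \<subseteq> Julia G"
  shows "bounded E"
proof (cases "infinity_in_Fatou G")
  case True
  then obtain R where R: "\<And>f :: nat \<Rightarrow> complex \<Rightarrow> complex. (\<forall>n. f n \<in> poly ` G) \<Longrightarrow>
      \<exists>r. strict_mono r \<and> unif_chordal_cauchy_on (f \<circ> r) {z. cmod z > R}"
    unfolding infinity_in_Fatou_def by blast
  have "normal_on (poly ` G) {z. cmod z > R}"
    unfolding normal_on_def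
  proof (intro allI impI)
    fix f :: "nat \<Rightarrow> complex \<Rightarrow> complex" assume "\<forall>n. f n \<in> poly ` G"
    from R[OF this] obtain r where r: "strict_mono r" "unif_chordal_cauchy_on (f \<circ> r) {z. cmod z > R}"
      by blast
    then show "\<exists>r. strict_mono r \<and> (\<forall>K. compact K \<and> K \<subseteq> {z. cmod z > R} \<longrightarrow> unif_chordal_cauchy_on (f \<circ> r) K)"
      using unif_chordal_cauchy_on_subset[OF r(2)] by blast
  qed
  moreover have "open {z::complex. cmod z > R}" by (intro open_Collect_less continuous_intros)
  ultimately have "z \<in> Fatou G" if "cmod z > R" for z
    unfolding Fatou_def using that by blast
  then have "Julia G \<subseteq> cball 0 R" by (force simp: Julia_def)
  then show ?thesis using E(2) bounded_cball bounded_subset by blast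
next
  case False
  show ?thesis
  proof (rule ccontr)
    assume unb: "\<not> bounded E"
    obtain B where B: "compact B" "B \<noteq> {}" "B \<subseteq> Julia G" "closed (Julia G - B)"
      using dis False unfolding Julia_disconnected_def by auto
    obtain V V' where V: "open V" "compact (closure V)" "open V'" "B \<subseteq> V" "Julia G - B \<subseteq> V'" "V \<inter> V' = {}"
      using separation_normal_compact[OF B(1,4)] by blast
    have "closure V \<inter> V' = {}"
      using V(3,6) by (simp add: inf_commute open_Int_closure_eq_empty)
    then have clV: "closure V \<inter> Julia G \<subseteq> V" using V(4,5) by blast
    obtain b where b: "b \<in> B" using B(2) by blast
    obtain a where a: "a \<in> E" using unb by force
    have "\<not> E \<subseteq> {a}" using unb bounded_subset[of "{a}"] by auto
    \<comment> \<open>Two points of \<open>E\<close> are needed as the values which the family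
      cannot both omit near \<open>b\<close>.\<close>
    then obtain a' where a': "a' \<in> E" "a \<noteq> a'" by blast
    have "b \<notin> Fatou G" using b B(3) by (auto simp: Julia_def)
    then obtain h w where h: "h \<in> G" and w: "w \<in> V" "poly h w \<in> E"
      using Fatou_if_omits[OF V(1) _ a'(2), of b G] b V(4) a a'(1) by blast
    \<comment> \<open>By backward invariance, points of \<open>closure V\<close> sent into
      \<open>E\<close> are Julia points, hence already lie in \<open>V\<close>. This makes one set
      both open and closed in \<open>E\<close>.\<close>
    have eq: "poly h ` V \<inter> E = poly h ` closure V \<inter> E"
      using clV closure_subset[of V] E(2) Julia_backward[OF h] by blast
    have "openin (top_of_set E) (poly h ` V \<inter> E)"
      using open_poly_image[OF degree_pos[OF h] V(1)] by (auto simp: openin_open)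
    moreover have "closedin (top_of_set E) (poly h ` closure V \<inter> E)"
      using compact_imp_closed[OF compact_continuous_image[OF continuous_on_poly_self V(2)]]
      by (auto simp: closedin_closed)
    moreover have "poly h ` V \<inter> E \<noteq> {}" using w by blast
    ultimately have "poly h ` V \<inter> E = E"
      using E(1) eq unfolding connected_clopen by metis
    then have "E \<subseteq> poly h ` closure V" using eq by blast
    then show False
      using unb compact_imp_bounded[OF compact_continuous_image[OF continuous_on_poly_self V(2)]]
        bounded_subset by blast
  qed
qed

section \<open>Directedness of the generators' filled Julia sets\<close>

lemma poly_semigroup_forward:
  assumes "\<And>h. h \<in> H \<Longrightarrow> poly h ` S \<subseteq> S" "p \<in> poly_semigroup H"
  shows "poly p ` S \<subseteq> S"
  using assms(2)
proof (induction rule: poly_semigroup.induct)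
  case (comp p q)
  then show ?case by (auto simp: poly_pcompose)
qed (rule assms(1))

text \<open>Let \<open>C h\<close> be the component of the Julia set containing \<open>J(h)\<close>.  A smallest one among the
  \<open>C h\<close> would have a forward invariant core, which would then be an open subset of the smallest
  filled Julia set containing \<open>J_min\<close>.  So there is none, and the sets \<open>K(h)\<close> are directed
  downwards.\<close>

lemma (in postcritically_bounded) Khat_eq_Inter_filled_connected:
  assumes G: "G = poly_semigroup H" and dis: "Julia_disconnected G"
    and Jm: "Jm \<in> components (Julia G)" "Jm \<inter> frontier (Khat G) \<noteq> {}"
      "\<And>h. h \<in> H \<Longrightarrow> Jm \<inter> Julia1 h = {}"
  shows "Khat G = (\<Inter>h\<in>H. filled h)" and "connected (Khat G)"
proof -
  have HG: "h \<in> G" if "h \<in> H" for h using that G by (auto intro: poly_semigroup.gen)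
  have Hne: "H \<noteq> {}"
  proof
    assume "H = {}"
    have "p \<notin> poly_semigroup {}" for p
      by (rule notI, induction p rule: poly_semigroup.induct) auto
    then show False using nonempty G \<open>H = {}\<close> by blast
  qed
  have "\<exists>C. C \<in> components (Julia G) \<and> Julia1 h \<subseteq> C" if "h \<in> H" for h
    using exists_component_superset[OF Julia1_subset_Julia[OF HG[OF that]] _ connected_Julia1[OF HG[OF that]]]
      Julia1_subset_Julia[OF HG[OF that]] Julia1_nonempty[OF HG[OF that]] by blast
  then obtain C where C: "\<And>h. h \<in> H \<Longrightarrow> C h \<in> components (Julia G)" "\<And>h. h \<in> H \<Longrightarrow> Julia1 h \<subseteq> C h"
    by metis
  have Cc: "compact (C h)" if "h \<in> H" for h
    using bounded_connected_subset_Julia[OF dis in_components_connected[OF C(1)[OF that]] in_components_subset[OF C(1)[OF that]]]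
      closed_components[OF closed_Julia C(1)[OF that]] by (simp add: compact_eq_bounded_closed)
  define lt where "lt f h \<longleftrightarrow> C f \<noteq> C h \<and> C f \<subseteq> interior (filled h)" for f h
  have comparable: "C f = C h \<or> lt f h \<or> lt h f" if "f \<in> H" "h \<in> H" for f h
    using Julia_component_comparable[OF HG HG C C] that unfolding lt_def by metis
  have lt_filled: "filled f \<subseteq> interior (filled h)" if "lt f h" "f \<in> H" "h \<in> H" for f h
  proof (rule subset_interior_if_frontier_subset_interior)
    show "frontier (filled f) \<subseteq> interior (filled h)"
      using that C(2)[of f] Julia1_eq[OF HG[of f]] by (auto simp: lt_def)
  qed (use that HG bounded_filled connected_Compl_filled in auto)
  have no_int: "\<not> Julia1 h \<subseteq> interior (filled h)" if "h \<in> H" for h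
    using Julia1_nonempty[OF HG[OF that]] Julia1_eq[OF HG[OF that]] by (auto simp: frontier_def)
  have antisym: "\<not> C h \<subseteq> interior (filled f)" if "lt f h" "f \<in> H" "h \<in> H" for f h
  proof
    assume "C h \<subseteq> interior (filled f)"
    then have "Julia1 h \<subseteq> interior (filled h)"
      using C(2)[OF that(3)] lt_filled[OF that] interior_subset[of "filled f"] by blast
    then show False using no_int[OF that(3)] by blast
  qed
  have trans: "lt e h" if "lt e f" "lt f h" "e \<in> H" "f \<in> H" "h \<in> H" for e f h
  proof -
    have "C e \<subseteq> interior (filled h)"
      using that lt_filled[OF that(2,4,5)] interior_subset[of "filled f"] by (auto simp: lt_def)
    then show ?thesis using C(2)[OF that(5)] no_int[OF that(5)] by (auto simp: lt_def)
  qed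
  \<comment> \<open>Two generators may share a component yet have different filled Julia sets, so
    \<open>lt e h\<close> does not follow by substitution; comparability of \<open>e\<close> and
    \<open>h\<close> decides.\<close>
  have lt_class: "lt e h" if "lt e f" "C f = C h" "e \<in> H" "f \<in> H" "h \<in> H" for e f h
  proof -
    have "C e \<noteq> C h" using that by (auto simp: lt_def)
    moreover have "\<not> lt h e" using antisym[OF that(1,3,4)] that(2) by (auto simp: lt_def)
    ultimately show ?thesis using comparable[OF that(3,5)] by blast
  qed
  have no_least: "\<exists>f\<in>H. lt f h" if h: "h \<in> H" for h
  proof (rule ccontr)
    assume no: "\<not> ?thesis"
    \<comment> \<open>With nothing below \<open>h\<close>, comparability gives exactly the
      alternative required by \<open>core_forward\<close> for every generator
      \<open>f\<close>.\<close>
    have inv: "poly f ` core (C h) \<subseteq> core (C h)" if f: "f \<in> H" for f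
    proof (rule core_forward[OF C(1)[OF h] Cc[OF h] HG[OF h] C(2)[OF h] HG[OF f]])
      show "Julia1 f \<subseteq> C h \<or> C h \<subseteq> interior (filled f)"
        using comparable[OF f h] no f C(2)[OF f] by (auto simp: lt_def)
    qed
    have "bounded (core (C h))"
      using core_subset_interior_filled[OF HG[OF h] C(2)[OF h]] interior_subset
        bounded_filled[OF HG[OF h]] bounded_subset by blast
    then have "core (C h) \<subseteq> Khat G"
      using poly_semigroup_forward[of H "core (C h)"] inv G by (intro bounded_forward_invariant_subset_Khat) auto
    moreover have "open (core (C h))" using open_core compact_imp_closed[OF Cc[OF h]] by blast
    ultimately have "core (C h) \<subseteq> interior (Khat G)" by (intro interior_maximal)
    moreover have "Jm \<subseteq> core (C h)"
    proof (rule connected_subset_core)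
      show "connected Jm" using in_components_connected[OF Jm(1)] .
      have "Jm \<noteq> C h" using Jm(3)[OF h] C(2)[OF h] Julia1_nonempty[OF HG[OF h]] by blast
      then show "Jm \<inter> C h = {}" using components_nonoverlap[OF Jm(1) C(1)[OF h]] by blast
      show "Jm \<inter> Khat G \<noteq> {}" using Jm(2) frontier_subset_closed[OF closed_Khat] by blast
    qed
    ultimately show False using Jm(2) by (auto simp: frontier_def)
  qed
  have below: "\<exists>e\<in>H. lt e f \<and> lt e h" if fh: "f \<in> H" "h \<in> H" for f h
  proof -
    obtain e where e: "e \<in> H" "lt e f" using no_least[OF fh(1)] by blast
    obtain e' where e': "e' \<in> H" "lt e' h" using no_least[OF fh(2)] by blast
    consider "C f = C h" | "lt f h" | "lt h f" using comparable[OF fh] by blast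
    then show ?thesis
    proof cases
      case 1
      then show ?thesis using lt_class[OF e(2) _ e(1) fh] e by blast
    next
      case 2
      then show ?thesis using trans[OF e(2) _ e(1) fh] e by blast
    next
      case 3
      then show ?thesis using trans[OF e'(2) _ e'(1) fh(2,1)] e' by blast
    qed
  qed
  have "(\<Inter>h\<in>H. filled h) \<subseteq> Khat G"
  proof (rule bounded_forward_invariant_subset_Khat)
    obtain h where h: "h \<in> H" using Hne by blast
    show "bounded (\<Inter>h\<in>H. filled h)"
      by (rule bounded_subset[OF bounded_filled[OF HG[OF h]]]) (rule INT_lower[OF h])
    have "poly p ` (\<Inter>h\<in>H. filled h) \<subseteq> (\<Inter>h\<in>H. filled h)" if p: "p \<in> H" for p
    proof (intro image_subsetI INT_I)
      fix x h assume x: "x \<in> (\<Inter>h\<in>H. filled h)" and h: "h \<in> H"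
      \<comment> \<open>Go two levels down: \<open>f\<close> lies below both \<open>p\<close> and
        \<open>h\<close>, and \<open>e\<close> lies below \<open>f\<close>. Then \<open>x\<close> is
        in \<open>K(e)\<close>, which sits in the hole of \<open>C f\<close>; that hole is invariant
        under \<open>p\<close> and contained in \<open>K(h)\<close>.\<close>
      obtain f where f: "f \<in> H" "lt f p" "lt f h" using below[OF p h] by blast
      obtain e where e: "e \<in> H" "lt e f" using no_least[OF f(1)] by blast
      have "filled e \<inter> C f = {}"
      proof (rule ccontr)
        assume "filled e \<inter> C f \<noteq> {}"
        moreover have "C f \<inter> C e = {}"
          using components_nonoverlap[OF C(1)[OF f(1)] C(1)[OF e(1)]] e(2) by (auto simp: lt_def)
        ultimately have "C f \<subseteq> interior (filled e)"
          using in_components_connected[OF C(1)[OF f(1)]] C(2)[OF e(1)] Julia1_eq[OF HG[OF e(1)]]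
          by (intro connected_subset_interior) auto
        then show False using antisym[OF e(2,1) f(1)] by blast
      qed
      moreover have "filled e \<inter> Khat G \<noteq> {}"
        using Khat_subset_filled[OF HG[OF e(1)]] Khat_nonempty by blast
      ultimately have "filled e \<subseteq> core (C f)"
        using connected_subset_core connected_filled[OF HG[OF e(1)]] by blast
      then have "x \<in> core (C f)" using x e(1) by blast
      then have "poly p x \<in> core (C f)"
        using core_forward[OF C(1)[OF f(1)] Cc[OF f(1)] HG[OF f(1)] C(2)[OF f(1)] HG[OF p]] f(2)
        by (auto simp: lt_def)
      then show "poly p x \<in> filled h"
        using core_subset_interior_filled[OF HG[OF f(1)] C(2)[OF f(1)]] lt_filled[OF f(3,1) h]
          interior_subset by blast
    qed
    then show "poly p ` (\<Inter>h\<in>H. filled h) \<subseteq> (\<Inter>h\<in>H. filled h)" if "p \<in> G" for p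
      using poly_semigroup_forward[of H] that G by blast
  qed
  then show eq: "Khat G = (\<Inter>h\<in>H. filled h)" using Khat_subset_filled HG by blast
  have "connected (\<Inter>(filled ` H))"
  proof (rule connected_Inter_directed)
    fix S T assume "S \<in> filled ` H" "T \<in> filled ` H"
    then obtain f h where fh: "f \<in> H" "h \<in> H" "S = filled f" "T = filled h" by blast
    obtain e where e: "e \<in> H" "lt e f" "lt e h" using below[OF fh(1,2)] by blast
    have "filled e \<subseteq> S \<inter> T"
      using order_trans[OF lt_filled[OF e(2,1) fh(1)] interior_subset]
        order_trans[OF lt_filled[OF e(3,1) fh(2)] interior_subset] fh(3,4) by simp
    then show "\<exists>R\<in>filled ` H. R \<subseteq> S \<inter> T" using e(1) by blast
  qed (use Hne compact_filled connected_filled HG in auto)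
  then show "connected (Khat G)" using eq by simp
qed

text \<open>A component of the closure of the generators' Julia sets not meeting the smallest filled
  Julia set is approximated by some connected \<open>J(h)\<close>, which encloses that set.\<close>

lemma (in postcritically_bounded) Khat_in_bounded_component_Compl:
  assumes H: "H \<subseteq> G" and con: "connected (Khat G)"
    and M: "M \<in> components (closure (\<Union>h\<in>H. Julia1 h))" "bounded M" "M \<inter> Khat G = {}"
    and U: "U \<in> components (- M)" "Khat G \<subseteq> U"
  shows "bounded U"
proof (rule ccontr)
  assume unb: "\<not> bounded U"
  define L where "L = closure (\<Union>h\<in>H. Julia1 h)"
  have M': "M \<in> components L" using M(1) by (simp add: L_def)
  have clM: "closed M" using closed_components[OF _ M'] by (simp add: L_def)
  then have cM: "compact M" using M(2) by (simp add: compact_eq_bounded_closed)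
  obtain r where r: "M \<subseteq> ball 0 r" using M(2) bounded_subset_ballD by blast
  \<comment> \<open>If \<open>U\<close> were unbounded, a path in \<open>U\<close> would lead from
    \<open>Khat G\<close> out of a disc around \<open>M\<close>.\<close>
  obtain p where p: "p \<in> U" "p \<notin> ball 0 r" using unb bounded_subset[OF bounded_ball] by blast
  obtain k where k: "k \<in> Khat G" using Khat_nonempty by blast
  have "open U" using open_components[OF _ U(1)] clM by auto
  then have "path_connected U"
    using in_components_connected[OF U(1)] by (simp add: connected_open_path_connected)
  then obtain \<gamma> where \<gamma>: "path \<gamma>" "path_image \<gamma> \<subseteq> U" "pathstart \<gamma> = k" "pathfinish \<gamma> = p"
    unfolding path_connected_def using k U(2) p(1) by blast
  have ends: "k \<in> path_image \<gamma>" "p \<in> path_image \<gamma>"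
    using \<gamma>(3,4) pathstart_in_path_image pathfinish_in_path_image by metis+
  \<comment> \<open>A clopen piece \<open>N\<close> of \<open>L\<close> contains \<open>M\<close>
    and avoids the path. Some \<open>J(h)\<close> meets \<open>N\<close> and, being connected, lies
    in \<open>N\<close>.\<close>
  have "open (ball 0 r - path_image \<gamma>)" using closed_path_image[OF \<gamma>(1)] by (simp add: open_Diff)
  moreover have "M \<subseteq> ball 0 r - path_image \<gamma>"
    using r \<gamma>(2) in_components_subset[OF U(1)] by blast
  ultimately obtain N where N: "openin (top_of_set L) N" "compact N" "M \<subseteq> N" "N \<subseteq> ball 0 r - path_image \<gamma>"
    using Sura_Bura_clopen_subset[OF closed_imp_locally_compact M' cM] L_def closed_closure by metis
  obtain T where T: "open T" "N = L \<inter> T" using N(1) by (auto simp: openin_open)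
  have "T \<inter> closure (\<Union>h\<in>H. Julia1 h) \<noteq> {}"
    using T N(3) in_components_nonempty[OF M'] by (auto simp: L_def)
  then obtain h y where h: "h \<in> H" "y \<in> Julia1 h" "y \<in> T"
    using open_Int_closure_eq_empty[OF T(1)] by blast
  have hG: "h \<in> G" using h(1) H by blast
  have JL: "Julia1 h \<subseteq> L" unfolding L_def by (rule order_trans[OF _ closure_subset]) (use h(1) in blast)
  have "Julia1 h \<inter> T = Julia1 h \<inter> N" using JL T(2) by blast
  then have "openin (top_of_set (Julia1 h)) (Julia1 h \<inter> N)" "closedin (top_of_set (Julia1 h)) (Julia1 h \<inter> N)"
    using T(1) compact_imp_closed[OF N(2)] by (metis openin_open_Int, metis closedin_closed_Int)
  moreover have "Julia1 h \<inter> N \<noteq> {}" using h(2,3) JL T(2) by blast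
  ultimately have "Julia1 h \<inter> N = Julia1 h"
    using connected_Julia1[OF hG] unfolding connected_clopen by blast
  then have JN: "Julia1 h \<subseteq> ball 0 r - path_image \<gamma>" using N(4) by blast
  \<comment> \<open>The path starts in \<open>K(h)\<close> and never crosses \<open>J(h)\<close>, so
    its endpoint is in \<open>K(h)\<close>; but \<open>J(h)\<close>, and with it
    \<open>K(h)\<close>, lies in the disc.\<close>
  have "path_image \<gamma> \<inter> frontier (filled h) = {}" using JN Julia1_eq[OF hG] by blast
  moreover have "path_image \<gamma> \<inter> filled h \<noteq> {}" using ends(1) k Khat_subset_filled[OF hG] by blast
  ultimately have "path_image \<gamma> \<subseteq> interior (filled h)"
    by (rule connected_subset_interior[OF connected_path_image[OF \<gamma>(1)]])
  moreover have "filled h \<subseteq> interior (ball 0 r)"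
  proof (rule subset_interior_if_frontier_subset_interior[OF bounded_filled[OF hG] bounded_ball])
    show "connected (- ball (0::complex) r)" by (rule connected_complement_bounded_convex) auto
    show "frontier (filled h) \<subseteq> interior (ball 0 r)"
      using JN Julia1_eq[OF hG] by (simp add: interior_open) blast
  qed
  ultimately show False using ends(2) p(2) interior_subset by blast
qed

theorem theorem4p13:
  fixes g :: "'i \<Rightarrow> complex poly" and \<Lambda> :: "'i set"
    and Jmin M' :: "complex set"
  defines "G \<equiv> poly_semigroup (g ` \<Lambda>)"
  assumes dis: "class_G_dis G"
    and Jmin_comp: "Jmin \<in> components (Julia G)"
    and Jmin_meets: "Jmin \<inter> frontier (Khat G) \<noteq> {}"
    and Jmin_disj: "Jmin \<inter> (\<Union>l\<in>\<Lambda>. Julia1 (g l)) = {}"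
    and M'_min: "minimal_component M' (closure (\<Union>l\<in>\<Lambda>. Julia1 (g l)))"
  shows "frontier (Khat G) \<subseteq> M' \<and> M' \<subseteq> closure (\<Union>l\<in>\<Lambda>. Julia1 (g l))"
proof -
  define H where "H = g ` \<Lambda>"
  define L where "L = closure (\<Union>h\<in>H. Julia1 h)"
  have L: "closure (\<Union>l\<in>\<Lambda>. Julia1 (g l)) = L" by (simp add: L_def H_def)
  have G: "G = poly_semigroup H" by (simp add: G_def H_def)
  have HG: "H \<subseteq> G" using G by (auto intro: poly_semigroup.gen)
  \<comment> \<open>With no elements every orbit is empty, so \<open>Khat G\<close> is the whole
    plane and has no frontier to meet.\<close>
  have "G \<noteq> {}"
  proof
    assume "G = {}"
    then have "Khat G = UNIV" by (simp add: Khat_def)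
    then show False using Jmin_meets by simp
  qed
  then interpret postcritically_bounded G
    using dis G by unfold_locales (auto simp: class_G_dis_def class_G_def intro: poly_semigroup.comp)
  have Jd: "Julia_disconnected G" using dis by (simp add: class_G_dis_def)
  have Jm: "Jmin \<inter> Julia1 h = {}" if "h \<in> H" for h
    using that Jmin_disj by (auto simp: H_def)
  have K: "Khat G = (\<Inter>h\<in>H. filled h)" "connected (Khat G)"
    using Khat_eq_Inter_filled_connected[OF G Jd Jmin_comp Jmin_meets Jm] by blast+
  have LJ: "L \<subseteq> Julia G"
    unfolding L_def using HG Julia1_subset_Julia by (intro closure_minimal closed_Julia) blast
  have frL: "frontier (Khat G) \<subseteq> L"
  proof
    fix z assume z: "z \<in> frontier (Khat G)"
    then have zK: "z \<in> Khat G" using frontier_subset_closed[OF closed_Khat] by blast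
    show "z \<in> L"
      unfolding L_def closure_approachable
    proof (intro allI impI)
      fix e :: real assume e: "e > 0"
      \<comment> \<open>Every disc around a frontier point leaves \<open>Khat G\<close>, hence
        leaves \<open>K(h)\<close> for some generator \<open>h\<close>; being connected, it meets
        \<open>J(h)\<close>.\<close>
      have "\<not> ball z e \<subseteq> Khat G"
        using z e mem_interior[of z "Khat G"] by (auto simp: frontier_def)
      then obtain h where h: "h \<in> H" "\<not> ball z e \<subseteq> filled h" using K(1) by blast
      have "z \<in> ball z e \<inter> filled h" using e zK K(1) h(1) by auto
      then have "ball z e \<inter> frontier (filled h) \<noteq> {}"
        using connected_Int_frontier[OF connected_ball, of z e "filled h"] h(2) by blast
      then obtain y where "y \<in> Julia1 h" "dist z y < e"
        using Julia1_eq[OF subsetD[OF HG h(1)]] by auto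
      then show "\<exists>y\<in>\<Union>h\<in>H. Julia1 h. dist y z < e"
        using h(1) by (metis UN_I dist_commute)
    qed
  qed
  have frne: "frontier (Khat G) \<noteq> {}" using Jmin_meets by blast
  have frK: "frontier (Khat G) \<subseteq> Khat G" using frontier_subset_closed[OF closed_Khat] .
  have "connected (frontier (Khat G))"
    using connected_frontier_simple[OF K(2) connected_Compl_Khat] .
  then obtain M0 where M0: "M0 \<in> components L" "frontier (Khat G) \<subseteq> M0"
    using exists_component_superset[OF frL] frL frne by blast
  have M': "M' \<in> components L" "\<And>C. C \<in> components L \<Longrightarrow> surr_le C M' \<Longrightarrow> C = M'"
    using M'_min unfolding minimal_component_def L by blast+
  \<comment> \<open>Any component of \<open>L\<close> other than \<open>M0\<close> misses
    \<open>Khat G\<close>, whose interior is in the Fatou set. It then surrounds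
    \<open>Khat G\<close> and with it \<open>M0\<close>, against minimality.\<close>
  have "M' = M0"
  proof (rule ccontr)
    assume ne: "M' \<noteq> M0"
    then have disj: "M' \<inter> M0 = {}" using components_nonoverlap[OF M'(1) M0(1)] by simp
    have "interior (Khat G) \<inter> Julia G = {}" using interior_Khat_subset_Fatou by (auto simp: Julia_def)
    moreover have "Khat G \<subseteq> interior (Khat G) \<union> frontier (Khat G)"
      using closure_subset by (auto simp: frontier_def)
    ultimately have MK: "M' \<inter> Khat G = {}"
      using disj M0(2) in_components_subset[OF M'(1)] LJ by blast
    have bM: "bounded M'"
      using bounded_connected_subset_Julia[OF Jd in_components_connected[OF M'(1)]]
        in_components_subset[OF M'(1)] LJ by blast
    obtain U where U: "U \<in> components (- M')" "Khat G \<subseteq> U"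
      using exists_component_superset[of "Khat G" "- M'"] MK K(2) Khat_nonempty by blast
    have "bounded U"
      using Khat_in_bounded_component_Compl[OF HG K(2) _ bM MK U] M'(1) by (simp add: L_def)
    moreover have "M0 \<subseteq> U"
      using components_maximal[OF U(1) in_components_connected[OF M0(1)]] disj U(2) frK frne M0(2) by blast
    ultimately have "surr_le M0 M'" using U(1) by (auto simp: surr_le_def)
    then show False using M'(2)[OF M0(1)] ne by blast
  qed
  then show ?thesis using M0(2) in_components_subset[OF M'(1)] L by blast
qed

end
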